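(* Fix an integer $k\ge0$ and, for each (sufficiently large) integer $\tilde m$, let $\tilde{\mathbf d}=\tilde{\mathbf d}^{(\tilde m)}=(\tilde d_1,\dots,\tilde d_{\tilde m})$ be a sequence of integers such that: (1) $\tilde d_j\ge1$ for all $1\le j\le\tilde m$ and $\tilde d_1=1$; (2) there is a probability mass function $(\tilde p_1,\tilde p_2,\dots)$ with $\tilde p_1>0$, $\sum_{i\ge1}i\tilde p_i=2$, $\sum_{i\ge1}i^2\tilde p_i<\infty$ such that, as $\tilde m\to\infty$, $\frac1{\tilde m}\#\{j:\tilde d_j=i\}\to\tilde p_i$ for all $i\ge1$ and $\frac1{\tilde m}\sum_{j}\tilde d_j^2\to\sum_{i\ge1}i^2\tilde p_i$; (3) $\sum_{j=1}^{\tilde m}\tilde d_j=2(\tilde m-1)+2k$. Let $\mathbb G^{\mathrm{con}}_{\tilde{\mathbf d}}$ be the set of all connected simple graphs on the vertex set $\{1,\dots,\tilde m\}$ in which vertex $j$ has degree $\tilde d_j$ for each $j$. Let $m=\tilde m-1+2k$, let $\xi_j=\tilde d_j-1$ for $2\le j\le\tilde m$ and $\xi_j=0$ for $\tilde m+1\le j\le\tilde m+2k$ (so $(\xi_j)$ is a valid child sequence for a tree on $m$ vertices), and let $\mathbf s=(s_i,i\ge0)$ with $s_i=\#\{2\le j\le\tilde m+2k:\xi_j=i\}$. With the notation of the context, construct a random graph $\mathcal G$ as follows (for $\tilde m$ such that $\mathbb T^{(k)}_{\mathbf s}$ is nonempty, which is the case for all large $\tilde m$): (a) Sample $(\tilde{\mathcal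 T}_{\mathbf s},\tilde X)$ uniformly from $\mathbb T^{(k)}_{\mathbf s}$ and write $\tilde X=\{(u_1,v_1),\dots,(u_k,v_k)\}$, where $(u_1,v_1)\ll\cdots\ll(u_k,v_k)$. (b) Label $u_j$ as $\tilde m+2j-1$ and $v_j$ as $\tilde m+2j$ for $1\le j\le k$. Label the other $\tilde m-1$ vertices of $\tilde{\mathcal T}_{\mathbf s}$ uniformly using the labels $2,\dots,\tilde m$ so that in the resulting labeled plane tree vertex $j$ has $\tilde d_j-1$ children for each $2\le j\le\tilde m$ (thus there are $(s_0-2k)!\prod_{i\ge1}s_i!$ such labelings). Call the resulting labeled plane tree $\tilde{\mathcal T}^{\mathrm{lab}}_{\mathbf s}$. (c) Form the labeled graph $\mathcal I(\tilde{\mathcal T}^{\mathrm{lab}}_{\mathbf s},\tilde X)$, attach a vertex labeled $1$ to the root by an edge, and then forget the planar order and the root. Let $\mathcal G$ be the resulting graph. Then $\mathcal G$ is uniformly distributed on $\mathbb G^{\mathrm{con}}_{\tilde{\mathbf d}}$.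
   Context: For a finite plane tree $t$ with root $\rho$: $\mathcal L(t)$ is the set of leaves (vertices with no children); for a non-root vertex $u$, $\overleftarrow u$ denotes its parent; $[\rho,u]$ (resp. $[\rho,u)$) is the ancestral line of $u$ including (resp. excluding) $u$; $x\prec_{DF}y$ means that $x$ is explored strictly before $y$ in the depth-first exploration of $t$ from the root (leftmost child first). Admissible pairs: for $u,v\in\mathcal L(t)$, the ordered pair $(u,v)$ is admissible if $\overleftarrow v\ne\rho$, $\overleftarrow{\overleftarrow v}\in[\rho,\overleftarrow u)$ and $\overleftarrow u\prec_{DF}\overleftarrow v$. $A(t)$ is the set of admissible pairs of $t$. The set $A(t)$ is given the linear order $\ll$ introduced as follows: $(u_1,v_1)\ll(u_2,v_2)$ if either $\overleftarrow{u_1}\prec_{DF}\overleftarrow{u_2}$, or $\overleftarrow{u_1}=\overleftarrow{u_2}$ and $\overleftarrow{v_1}\prec_{DF}\overleftarrow{v_2}$. For $k\ge1$, $A_k(t)$ is the set of all collections $\{(u_1,v_1),\dots,(u_k,v_k)\}$ with $(u_j,v_j)\in A(t)$ for each $j$ and such that $u_1,v_1,\dots,u_k,v_k$ are $2k$ distinct leaves. For $k=0$, $A_0(t)$ has the single element $\emptyset$. $\mathbb T_{\mathbf s}$ is the set of plane trees having, for each $i\ge0$, exactly $s_i$ vertices with $i$ children. $\mathbb T_{\mathbf s}^{(k)}$ is the set of all pairs $(t,x)$ with $t\in\mathbb T_{\mathbf s}$ and $x\in A_k(t)$. For a labeled plane tree $t^{\mathrm{lab}}$ (a plane tree whose vertices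 are labeled) and $x=\{(u_1,v_1),\dots,(u_k,v_k)\}\in A_k(t^{\mathrm{lab}})$, $\mathcal I(t^{\mathrm{lab}},x)$ is the rooted labeled graph obtained from $t^{\mathrm{lab}}$ by adding an edge between $\overleftarrow{u_j}$ and $\overleftarrow{v_j}$, and deleting $u_j,v_j$ and the two edges incident to them, for $j=1,\dots,k$, retaining the vertex labels.
   Formalization: For k≥2, step (a) samples uniformly only from those (t,x) whose collection x can be written (u_1,v_1)≪…≪(u_k,v_k); collections containing two pairs with the same parents (≪-incomparable, giving a double edge) are excluded, and "nonempty" refers to this smaller set. *)

theory Defs
  imports "HOL-Probability.Probability" "HOL-Library.Sublist"
begin

section \<open>Plane trees\<close>

text \<open>
  Plane trees are in Neveu's form: a vertex is the word of child positions (counted from 0, left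
  to right) on the path leading to it from the root, which is the empty word, and a tree is its
  set of vertices.
\<close>

type_synonym vertex = "nat list"
type_synonym tree = "vertex set"

definition plane_tree :: "tree \<Rightarrow> bool" where
  "plane_tree t \<longleftrightarrow> finite t \<and> [] \<in> t \<and> (\<forall>u i. u @ [i] \<in> t \<longrightarrow> u \<in> t \<and> (\<forall>j<i. u @ [j] \<in> t))"

definition num_children :: "tree \<Rightarrow> vertex \<Rightarrow> nat" where
  "num_children t u = card {i. u @ [i] \<in> t}"

definition leaves :: "tree \<Rightarrow> vertex set" where
  "leaves t = {u \<in> t. num_children t u = 0}"

text \<open>For the root this yields the junk value \<open>[]\<close>.\<close>

abbreviation parent :: "vertex \<Rightarrow> vertex" where
  "parent \<equiv> butlast"

text \<open>
  Depth-first exploration, leftmost child first, visits the words in lexicographic order, a proper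
  prefix (ancestor) coming before its extensions.
\<close>

definition df_less :: "vertex \<Rightarrow> vertex \<Rightarrow> bool" (infix "\<prec>\<^sub>D\<^sub>F" 50) where
  "u \<prec>\<^sub>D\<^sub>F v \<longleftrightarrow> ord_class.lexordp u v"

definition trees_with_counts :: "(nat \<Rightarrow> nat) \<Rightarrow> tree set" where
  "trees_with_counts s = {t. plane_tree t \<and> (\<forall>i. card {u \<in> t. num_children t u = i} = s i)}"

section \<open>Admissible pairs\<close>

text \<open>
  \<open>strict_prefix w (parent u)\<close> says that \<open>w\<close> lies on the ancestral line from the root to
  \<open>parent u\<close>, with \<open>parent u\<close> excluded. The conditions force \<open>u\<close> and \<open>v\<close> to be different from the
  root, so the junk value of \<^const>\<open>butlast\<close> plays no role.
\<close>

definition admissible_pairs :: "tree \<Rightarrow> (vertex \<times> vertex) set" where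
  "admissible_pairs t = {(u, v). u \<in> leaves t \<and> v \<in> leaves t \<and> parent v \<noteq> [] \<and>
     strict_prefix (parent (parent v)) (parent u) \<and> parent u \<prec>\<^sub>D\<^sub>F parent v}"

definition pair_less :: "vertex \<times> vertex \<Rightarrow> vertex \<times> vertex \<Rightarrow> bool" (infix "\<lless>" 50) where
  "a \<lless> b \<longleftrightarrow> parent (fst a) \<prec>\<^sub>D\<^sub>F parent (fst b) \<or>
     parent (fst a) = parent (fst b) \<and> parent (snd a) \<prec>\<^sub>D\<^sub>F parent (snd b)"

definition admissible_collections :: "nat \<Rightarrow> tree \<Rightarrow> (vertex \<times> vertex) set set" where
  "admissible_collections k t = {set ps | ps. length ps = k \<and> set ps \<subseteq> admissible_pairs t \<and>
     distinct (map fst ps @ map snd ps)}"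

definition trees_with_collections ::
  "(nat \<Rightarrow> nat) \<Rightarrow> nat \<Rightarrow> (tree \<times> (vertex \<times> vertex) set) set" where
  "trees_with_collections s k =
     {(t, x). t \<in> trees_with_counts s \<and> x \<in> admissible_collections k t}"

text \<open>
  The relation \<open>\<lless>\<close> compares parents only. Two different admissible pairs \<open>(u, v)\<close> and \<open>(u', v')\<close>
  with \<open>parent u = parent u'\<close> and \<open>parent v = parent v'\<close> are therefore incomparable, and a
  collection containing two such pairs cannot be written as
  \<open>(u\<^sub>1, v\<^sub>1) \<lless> \<dots> \<lless> (u\<^sub>k, v\<^sub>k)\<close>; gluing along it would create a double edge. The random
  construction requires this way of writing the collection, so it samples from the pairs \<open>(t, x)\<close>
  for which it exists. For \<open>k \<le> 1\<close> these are all the elements of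
  \<^term>\<open>trees_with_collections s k\<close>.
\<close>

definition ordered_trees_with_collections ::
  "(nat \<Rightarrow> nat) \<Rightarrow> nat \<Rightarrow> (tree \<times> (vertex \<times> vertex) set) set" where
  "ordered_trees_with_collections s k =
     {(t, x) \<in> trees_with_collections s k. \<exists>ps. set ps = x \<and> sorted_wrt (\<lless>) ps}"

lemma ordered_trees_with_collections_le_1:
  assumes "k \<le> 1"
  shows "ordered_trees_with_collections s k = trees_with_collections s k"
proof -
  have "sorted_wrt (\<lless>) ps" if "length ps = k" for ps
    using that assms by (cases ps) auto
  then show ?thesis
    unfolding ordered_trees_with_collections_def trees_with_collections_def
      admissible_collections_def by blast
qed

definition ordered_list :: "(vertex \<times> vertex) set \<Rightarrow> (vertex \<times> vertex) list" where
  "ordered_list x = (THE ps. set ps = x \<and> sorted_wrt (\<lless>) ps)"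

section \<open>Labeled graphs\<close>

type_synonym graph = "nat set \<times> nat set set"

definition simple_graph :: "graph \<Rightarrow> bool" where
  "simple_graph = (\<lambda>(V, E). finite V \<and> (\<forall>e\<in>E. e \<subseteq> V \<and> card e = 2))"

definition connected_graph :: "graph \<Rightarrow> bool" where
  "connected_graph = (\<lambda>(V, E). V \<noteq> {} \<and> (\<forall>a\<in>V. \<forall>b\<in>V. (a, b) \<in> {(a, b). {a, b} \<in> E}\<^sup>*))"

definition graph_degree :: "graph \<Rightarrow> nat \<Rightarrow> nat" where
  "graph_degree = (\<lambda>(V, E) a. card {e \<in> E. a \<in> e})"

definition connected_graphs_with_degrees :: "nat \<Rightarrow> (nat \<Rightarrow> nat) \<Rightarrow> graph set" where
  "connected_graphs_with_degrees m d = {G. fst G = {1..m} \<and> simple_graph G \<and> connected_graph G \<and>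
     (\<forall>j\<in>{1..m}. graph_degree G j = d j)}"

text \<open>
  The rooted graph \<open>\<I>(t, x)\<close> of the plane tree \<open>t\<close> with vertex labels \<open>lab\<close>, as a triple of its
  vertices, its edges and its root. An edge of \<open>t\<close> is given by its lower end \<open>w\<close>; the edges incident
  to a leaf are those with that leaf as lower end.
\<close>

definition glued_graph ::
  "tree \<Rightarrow> (vertex \<Rightarrow> nat) \<Rightarrow> (vertex \<times> vertex) set \<Rightarrow> nat set \<times> nat set set \<times> nat" where
  "glued_graph t lab x = (let kept = t - (fst ` x \<union> snd ` x) in
     (lab ` kept,
      {{lab (parent w), lab w} | w. w \<in> kept \<and> w \<noteq> []} \<union>
        {{lab (parent u), lab (parent v)} | u v. (u, v) \<in> x},
      lab []))"

definition attach_and_unroot :: "nat \<Rightarrow> nat set \<times> nat set set \<times> nat \<Rightarrow> graph" where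
  "attach_and_unroot a = (\<lambda>(V, E, r). (insert a V, insert {a, r} E))"

section \<open>The random graph\<close>

text \<open>
  Here \<open>m\<close> is the number of vertices of the graph and \<open>d 1, \<dots>, d m\<close> are its degrees; the tree has
  \<open>m - 1 + 2 * k\<close> vertices, labeled by \<open>2, \<dots>, m + 2 * k\<close>.
\<close>

definition child_seq :: "nat \<Rightarrow> (nat \<Rightarrow> nat) \<Rightarrow> nat \<Rightarrow> nat" where
  "child_seq m d j = (if j \<le> m then d j - 1 else 0)"

definition child_counts :: "nat \<Rightarrow> nat \<Rightarrow> (nat \<Rightarrow> nat) \<Rightarrow> nat \<Rightarrow> nat" where
  "child_counts k m d i = card {j \<in> {2..m + 2 * k}. child_seq m d j = i}"

text \<open>
  List positions start at 0, so \<open>ps ! j\<close> is the pair \<open>(u\<^sub>j\<^sub>+\<^sub>1, v\<^sub>j\<^sub>+\<^sub>1)\<close>. Labelings are fixed to be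
  \<^const>\<open>undefined\<close> off the tree, so that there are finitely many of them.
\<close>

definition labelings ::
  "nat \<Rightarrow> (nat \<Rightarrow> nat) \<Rightarrow> tree \<Rightarrow> (vertex \<times> vertex) list \<Rightarrow> (vertex \<Rightarrow> nat) set" where
  "labelings m d t ps = {lab \<in> extensional t.
     bij_betw lab t {2..m + 2 * length ps} \<and>
     (\<forall>j<length ps. lab (fst (ps ! j)) = m + 2 * j + 1 \<and> lab (snd (ps ! j)) = m + 2 * j + 2) \<and>
     (\<forall>w\<in>t. lab w \<le> m \<longrightarrow> num_children t w = d (lab w) - 1)}"

definition random_graph :: "nat \<Rightarrow> nat \<Rightarrow> (nat \<Rightarrow> nat) \<Rightarrow> graph pmf" where
  "random_graph k m d = do {
     (t, x) \<leftarrow> pmf_of_set (ordered_trees_with_collections (child_counts k m d) k);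
     lab \<leftarrow> pmf_of_set (labelings m d t (ordered_list x));
     return_pmf (attach_and_unroot 1 (glued_graph t lab x))
   }"

end

theory Submission
  imports Defs
begin

text \<open>
  Gluing an admissible pair \<open>(u, v)\<close> adds an edge between \<open>parent u\<close> and a vertex that is already
  discovered but not yet explored when the depth-first exploration reaches \<open>parent u\<close>. Hence the tree
  is the exploration tree of the glued graph \<open>G\<close>: the parent of a vertex is its first explored
  neighbour, and a leaf \<open>u\<close> or \<open>v\<close> marks the place of a non-tree edge among the other edges at its
  parent. Conversely, if at every vertex \<open>j \<ge> 2\<close> the \<open>d j - 1\<close> edges not leading to the parent are
  ordered, there is exactly one exploration of \<open>G\<close> compatible with these orders, and it yields a
  labelled tree with a collection of admissible pairs that is glued to \<open>G\<close>. So every connected graph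
  with the given degrees arises from the same number \<open>\<Prod> (d j - 1)!\<close> of labelled trees with
  collections. The number of labelings of a tree does not depend on the tree either, so the random
  graph is uniform.
\<close>

section \<open>The depth-first order and admissible pairs\<close>

text \<open>The exploration is described statically, by a word \<open>pos\<close> and a parent
  \<open>par\<close> for every vertex, the parent being the neighbour with the first word. As each
  of the two depends on the other, existence and uniqueness need separate arguments: existence
  produces a marked tree for each code, uniqueness shows that graph and code determine the marked
  tree. The link to admissibility: for leaves, \<open>(u, v)\<close> is admissible exactly when
  \<open>parent u\<close> lies strictly between \<open>parent (parent v)\<close> and
  \<open>parent v\<close>, so a glued edge never gives a vertex a neighbour earlier than its parent.
  Vertex 1 acts as the parent of the root, so that the root has \<open>d j - 1\<close> remaining
  edges like every other vertex. Two pairs with the same two parents would produce one edge instead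
  of two and spoil the degrees; this is why the collections must be sortable by
  \<open>\<lless>\<close>. Neither the fibre size nor the number of labelings is evaluated: being
  constant is enough. Nonemptiness for large \<open>m\<close> rests on the mean being 2 with
  \<open>pmf p 1 > 0\<close>, which forces a degree of at least 3 with positive frequency.\<close>

lemma df_less_irrefl [simp]: "\<not> u \<prec>\<^sub>D\<^sub>F u"
  unfolding df_less_def by (rule lexordp_irreflexive')

lemma df_less_trans [trans]: "u \<prec>\<^sub>D\<^sub>F v \<Longrightarrow> v \<prec>\<^sub>D\<^sub>F w \<Longrightarrow> u \<prec>\<^sub>D\<^sub>F w"
  unfolding df_less_def by (rule lexordp_trans)

lemma df_less_asym: "u \<prec>\<^sub>D\<^sub>F v \<Longrightarrow> \<not> v \<prec>\<^sub>D\<^sub>F u"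
  using df_less_trans df_less_irrefl by blast

lemma df_less_linear: "u \<prec>\<^sub>D\<^sub>F v \<or> u = v \<or> v \<prec>\<^sub>D\<^sub>F u"
  unfolding df_less_def by (rule lexordp_linear)

lemma df_first_exists:
  assumes "finite W" "W \<noteq> {}"
  shows "\<exists>w\<in>W. \<forall>w'\<in>W. \<not> w' \<prec>\<^sub>D\<^sub>F w"
proof -
  have "\<exists>w\<in>W. \<forall>w'\<in>W. w' \<noteq> w \<longrightarrow> \<not> w' \<prec>\<^sub>D\<^sub>F w"
    using assms by (intro Finite_Set.bex_min_element)
      (auto simp: asymp_on_def transp_on_def dest: df_less_asym df_less_trans)
  then show ?thesis by (metis df_less_irrefl)
qed

lemma df_less_simps [simp]:
  "\<not> u \<prec>\<^sub>D\<^sub>F []" "[] \<prec>\<^sub>D\<^sub>F u \<longleftrightarrow> u \<noteq> []"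
  "i # u \<prec>\<^sub>D\<^sub>F j # v \<longleftrightarrow> i < j \<or> i = j \<and> u \<prec>\<^sub>D\<^sub>F v"
  by (cases u; auto simp: df_less_def)+

lemma df_less_append [simp]: "u \<prec>\<^sub>D\<^sub>F u @ v \<longleftrightarrow> v \<noteq> []"
  unfolding df_less_def by (metis append_Nil2 lexordp_append_rightI lexordp_irreflexive')

lemma df_less_snoc: "u \<prec>\<^sub>D\<^sub>F u @ [i]"
  by simp

lemma strict_prefix_imp_df_less: "strict_prefix u v \<Longrightarrow> u \<prec>\<^sub>D\<^sub>F v"
  by (auto simp: strict_prefix_def prefix_def)

lemma df_less_parent: "u \<noteq> [] \<Longrightarrow> parent u \<prec>\<^sub>D\<^sub>F u"
  by (metis append_butlast_last_id df_less_snoc)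

text \<open>The subtree of \<open>c\<close> is an interval of the depth-first order beginning at
  \<open>c\<close>, so nothing outside it can come between \<open>c\<close> and a child of
  \<open>c\<close>.\<close>

lemma strict_prefix_if_df_between:
  "c \<prec>\<^sub>D\<^sub>F a \<Longrightarrow> a \<prec>\<^sub>D\<^sub>F c @ [i] \<Longrightarrow> strict_prefix c a"
proof (induction c arbitrary: a)
  case Nil
  then show ?case by (simp add: strict_prefix_def)
next
  case (Cons x c)
  then show ?case by (cases a) auto
qed

text \<open>Turns the ancestor condition into an order condition: when \<open>parent u\<close> is
  explored, \<open>parent (parent v)\<close> has been explored and \<open>parent v\<close> has not,
  i.e. \<open>parent v\<close> is discovered and still waiting. Later arguments use admissibility in
  this form.\<close>

lemma admissible_pairs_iff:
  "(u, v) \<in> admissible_pairs t \<longleftrightarrow> u \<in> leaves t \<and> v \<in> leaves t \<and> parent v \<noteq> [] \<and>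
     parent (parent v) \<prec>\<^sub>D\<^sub>F parent u \<and> parent u \<prec>\<^sub>D\<^sub>F parent v"
  unfolding admissible_pairs_def
  using strict_prefix_imp_df_less
    strict_prefix_if_df_between[of "parent (parent v)" "parent u" "last (parent v)"]
  by auto

section \<open>The order on pairs and the collections that can be sorted by it\<close>

lemma pair_less_irrefl [simp]: "\<not> a \<lless> a"
  by (simp add: pair_less_def)

lemma pair_less_trans: "a \<lless> b \<Longrightarrow> b \<lless> c \<Longrightarrow> a \<lless> c"
  unfolding pair_less_def by (auto dest: df_less_trans)

lemma pair_less_linear:
  "a \<lless> b \<or> b \<lless> a \<or> map_prod parent parent a = map_prod parent parent b"
  unfolding pair_less_def using df_less_linear by (cases a; cases b) (simp, blast)

lemma pair_less_asym: "a \<lless> b \<Longrightarrow> \<not> b \<lless> a"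
  using pair_less_trans pair_less_irrefl by blast

lemma sorted_pair_less_distinct: "sorted_wrt (\<lless>) ps \<Longrightarrow> distinct ps"
  by (induction ps) auto

text \<open>Both lists start with the minimum of their common set. This makes the definite
  description in \<open>ordered_list\<close> meaningful.\<close>

lemma sorted_pair_less_unique:
  "sorted_wrt (\<lless>) ps \<Longrightarrow> sorted_wrt (\<lless>) qs \<Longrightarrow> set ps = set qs \<Longrightarrow> ps = qs"
proof (induction ps arbitrary: qs)
  case (Cons a ps)
  then obtain b qs' where qs: "qs = b # qs'" by (cases qs) auto
  have "a = b"
    using Cons.prems unfolding qs
    by (metis insert_iff list.set(2) pair_less_asym sorted_wrt.simps(2))
  moreover have "a \<notin> set ps" "b \<notin> set qs'"
    using Cons.prems unfolding qs by auto
  ultimately show ?case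
    using Cons.IH[of qs'] Cons.prems unfolding qs
    by (auto simp: insert_ident)
qed auto

text \<open>Selection sort. Incomparable pairs have the same two parents, so injectivity of
  \<open>map_prod parent parent\<close> makes \<open>\<lless>\<close> a strict linear order on
  \<open>x\<close>.\<close>

lemma sorted_pair_less_exists:
  assumes "finite x" "inj_on (map_prod parent parent) x"
  shows "\<exists>ps. set ps = x \<and> sorted_wrt (\<lless>) ps"
  using assms
proof (induction "card x" arbitrary: x)
  case (Suc n)
  have "\<exists>a\<in>x. \<forall>b\<in>x. b \<noteq> a \<longrightarrow> \<not> b \<lless> a"
    using Suc.hyps(2) Suc.prems(1)
    by (intro Finite_Set.bex_min_element)
      (auto simp: asymp_on_def transp_on_def dest: pair_less_asym pair_less_trans)
  then obtain a where a: "a \<in> x" "\<And>b. b \<in> x \<Longrightarrow> \<not> b \<lless> a" by (metis pair_less_irrefl)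
  obtain ps where ps: "set ps = x - {a}" "sorted_wrt (\<lless>) ps"
    using Suc.hyps(1)[of "x - {a}"] Suc.prems a(1) Suc.hyps(2)[symmetric]
    by (auto simp: inj_on_diff)
  have "a \<lless> b" if "b \<in> x - {a}" for b
    using pair_less_linear[of a b] inj_onD[OF Suc.prems(2)] a that by blast
  then have "set (a # ps) = x \<and> sorted_wrt (\<lless>) (a # ps)"
    using ps a(1) by auto
  then show ?case by blast
qed auto

text \<open>The list-free form of the collections that are sampled, with \<open>k\<close> and
  \<open>s\<close> left out so that it also applies to subtrees. The last conjunct amounts both to
  \<open>x\<close> being sortable by \<open>\<lless>\<close> and to no two pairs being glued to the
  same edge.\<close>

definition gluing :: "tree \<Rightarrow> (vertex \<times> vertex) set \<Rightarrow> bool" where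
  "gluing t x \<longleftrightarrow> finite x \<and> x \<subseteq> admissible_pairs t \<and> inj_on fst x \<and> inj_on snd x \<and>
     fst ` x \<inter> snd ` x = {} \<and> inj_on (map_prod parent parent) x"

lemma ordered_trees_with_collections_iff:
  "(t, x) \<in> ordered_trees_with_collections s k \<longleftrightarrow>
     t \<in> trees_with_counts s \<and> gluing t x \<and> card x = k"
proof
  assume "(t, x) \<in> ordered_trees_with_collections s k"
  then obtain ps qs where t: "t \<in> trees_with_counts s"
    and ps: "length ps = k" "set ps \<subseteq> admissible_pairs t" "set ps = x"
      "distinct (map fst ps @ map snd ps)"
    and qs: "set qs = x" "sorted_wrt (\<lless>) qs"
    by (auto simp: ordered_trees_with_collections_def trees_with_collections_def
        admissible_collections_def)
  have "distinct ps" using ps(4) by (simp add: distinct_map)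
  moreover have "inj_on (map_prod parent parent) x"
  proof (rule inj_onI)
    fix a b assume ab: "a \<in> x" "b \<in> x" "map_prod parent parent a = map_prod parent parent b"
    then have "\<not> a \<lless> b" "\<not> b \<lless> a"
      by (cases a; cases b; auto simp: pair_less_def)+
    then show "a = b"
      using qs ab(1,2) by (metis in_set_conv_nth linorder_neqE_nat sorted_wrt_iff_nth_less)
  qed
  ultimately show "t \<in> trees_with_counts s \<and> gluing t x \<and> card x = k"
    using t ps distinct_card[of ps] by (auto simp: gluing_def distinct_map)
next
  assume *: "t \<in> trees_with_counts s \<and> gluing t x \<and> card x = k"
  then obtain ps where ps: "set ps = x" "sorted_wrt (\<lless>) ps"
    using sorted_pair_less_exists[of x] unfolding gluing_def by auto
  moreover have "distinct ps" using ps sorted_pair_less_distinct by blast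
  ultimately have "length ps = k" "set ps \<subseteq> admissible_pairs t" "distinct (map fst ps @ map snd ps)"
    using * distinct_card[of ps] by (auto simp: gluing_def distinct_map)
  with ps have "x \<in> admissible_collections k t"
    unfolding admissible_collections_def by blast
  with ps * show "(t, x) \<in> ordered_trees_with_collections s k"
    unfolding ordered_trees_with_collections_def trees_with_collections_def by blast
qed

lemma gluing_ordered_list:
  assumes "gluing t x"
  shows "set (ordered_list x) = x" "sorted_wrt (\<lless>) (ordered_list x)" "distinct (ordered_list x)"
    "length (ordered_list x) = card x"
proof -
  obtain ps where ps: "set ps = x" "sorted_wrt (\<lless>) ps"
    using assms sorted_pair_less_exists[of x] unfolding gluing_def by auto
  then have "ordered_list x = ps"
    unfolding ordered_list_def by (intro the_equality) (auto dest: sorted_pair_less_unique)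
  with ps show *: "set (ordered_list x) = x" "sorted_wrt (\<lless>) (ordered_list x)" by auto
  show "distinct (ordered_list x)"
    using *(2) by (rule sorted_pair_less_distinct)
  then show "length (ordered_list x) = card x"
    using *(1) distinct_card[of "ordered_list x"] by simp
qed

lemma gluingI:
  assumes "finite x" "\<And>u v. (u, v) \<in> x \<Longrightarrow> (u, v) \<in> admissible_pairs t"
    and "\<And>u v u' v'. (u, v) \<in> x \<Longrightarrow> (u', v') \<in> x \<Longrightarrow> u = u' \<longleftrightarrow> v = v'"
    and "\<And>u v u' v'. (u, v) \<in> x \<Longrightarrow> (u', v') \<in> x \<Longrightarrow> u \<noteq> v'"
    and "\<And>u v u' v'. (u, v) \<in> x \<Longrightarrow> (u', v') \<in> x \<Longrightarrow>
      parent u = parent u' \<Longrightarrow> parent v = parent v' \<Longrightarrow> u = u' \<and> v = v'"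
  shows "gluing t x"
proof -
  have "x \<subseteq> admissible_pairs t" using assms(2) by auto
  moreover have "inj_on fst x" "inj_on snd x" "inj_on (map_prod parent parent) x"
    using assms(3,5) by (auto simp: inj_on_def)
  moreover have "fst ` x \<inter> snd ` x = {}" using assms(4) by fastforce
  ultimately show ?thesis using assms(1) by (simp add: gluing_def)
qed

lemma gluingD:
  assumes "gluing t x" "(u, v) \<in> x"
  shows "u \<in> leaves t" "v \<in> leaves t" "parent v \<noteq> []" "parent (parent v) \<prec>\<^sub>D\<^sub>F parent u"
    "parent u \<prec>\<^sub>D\<^sub>F parent v" "u \<noteq> []" "v \<noteq> []"
proof -
  show *: "u \<in> leaves t" "v \<in> leaves t" "parent v \<noteq> []" "parent (parent v) \<prec>\<^sub>D\<^sub>F parent u"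
    "parent u \<prec>\<^sub>D\<^sub>F parent v"
    using assms by (auto simp: gluing_def admissible_pairs_iff)
  then show "u \<noteq> []" "v \<noteq> []" by auto
qed

lemma gluing_inj:
  assumes "gluing t x" "(u, v) \<in> x" "(u', v') \<in> x"
  shows "u = u' \<longleftrightarrow> v = v'" "u \<noteq> v'"
    "parent u = parent u' \<Longrightarrow> parent v = parent v' \<Longrightarrow> u = u' \<and> v = v'"
proof -
  have *: "inj_on fst x" "inj_on snd x" "fst ` x \<inter> snd ` x = {}" "inj_on (map_prod parent parent) x"
    using assms(1) by (auto simp: gluing_def)
  show "u = u' \<longleftrightarrow> v = v'"
    using inj_onD[OF *(1) _ assms(2,3)] inj_onD[OF *(2) _ assms(2,3)] by fastforce
  have "u \<in> fst ` x" "v' \<in> snd ` x"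
    using assms(2,3) by force+
  then show "u \<noteq> v'" using *(3) by blast
  show "parent u = parent u' \<Longrightarrow> parent v = parent v' \<Longrightarrow> u = u' \<and> v = v'"
    using inj_onD[OF *(4) _ assms(2,3)] by simp
qed

section \<open>Depth-first exploration of a graph\<close>

text \<open>\<open>slot j p q\<close> is the place of \<open>q\<close> among the children of
  \<open>j\<close> when \<open>p\<close> is the parent of \<open>j\<close>; the parent is an
  argument because it is known only during the exploration. \<open>outside\<close> stands in as
  parent of the root and will be vertex 1. Connectivity is stated as the absence of a proper closed
  subset containing \<open>r\<close>, the form that keeps the exploration going.\<close>

locale explored_graph =
  fixes V :: "'a set" and N :: "'a \<Rightarrow> 'a set" and r :: 'a and outside :: 'a
    and slot :: "'a \<Rightarrow> 'a \<Rightarrow> 'a \<Rightarrow> nat"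
  assumes finite_V: "finite V"
    and r: "r \<in> V"
    and outside: "outside \<notin> V"
    and N_subset: "j \<in> V \<Longrightarrow> N j \<subseteq> V"
    and N_sym: "j \<in> V \<Longrightarrow> q \<in> N j \<Longrightarrow> j \<in> N q"
    and N_irrefl: "j \<notin> N j"
    and connected: "S \<subseteq> V \<Longrightarrow> r \<in> S \<Longrightarrow> (\<And>j. j \<in> S \<Longrightarrow> N j \<subseteq> S) \<Longrightarrow> S = V"
    and slot_inj: "j \<in> V \<Longrightarrow> p \<in> N j \<or> j = r \<and> p = outside \<Longrightarrow>
      q \<in> N j - {p} \<Longrightarrow> q' \<in> N j - {p} \<Longrightarrow> slot j p q = slot j p q' \<Longrightarrow> q = q'"
begin

text \<open>A fixed-point description of the finished exploration: words are computed from parents,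
  and parents are the neighbours with the first words.\<close>

definition dfs_labelling :: "('a \<Rightarrow> vertex) \<Rightarrow> ('a \<Rightarrow> 'a) \<Rightarrow> bool" where
  "dfs_labelling pos par \<longleftrightarrow> inj_on pos V \<and> pos r = [] \<and> par r = outside \<and>
     (\<forall>q\<in>V - {r}. par q \<in> N q \<and> pos q = pos (par q) @ [slot (par q) (par (par q)) q] \<and>
       (\<forall>a\<in>N q. \<not> pos a \<prec>\<^sub>D\<^sub>F pos (par q)))"

text \<open>Induction on depth. Every proper ancestor of \<open>b\<close> has its word strictly
  before \<open>w\<close>, so all parents on the line to \<open>b\<close> are undisputed and the two
  recursions for the words read the same data.\<close>

lemma dfs_labelling_agree:
  assumes "dfs_labelling pos par" "dfs_labelling pos' par'"
    and "\<And>q. q \<in> V - {r} \<Longrightarrow> pos (par q) \<prec>\<^sub>D\<^sub>F w \<Longrightarrow> par' q = par q"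
    and "b \<in> V" "\<not> w \<prec>\<^sub>D\<^sub>F pos b"
  shows "pos' b = pos b \<and> par' b = par b"
  using assms(4,5)
proof (induction "length (pos b)" arbitrary: b rule: less_induct)
  case less
  show ?case
  proof (cases "b = r")
    case False
    then have b: "b \<in> V - {r}" using less.prems by simp
    with assms(1) have pb: "par b \<in> N b" "pos b = pos (par b) @ [slot (par b) (par (par b)) b]"
      by (auto simp: dfs_labelling_def)
    then have lt: "pos (par b) \<prec>\<^sub>D\<^sub>F pos b" by (metis df_less_snoc)
    then have lt': "pos (par b) \<prec>\<^sub>D\<^sub>F w"
      using less.prems df_less_linear df_less_trans by metis
    then have eq: "par' b = par b" using assms(3)[OF b] by simp
    have "length (pos (par b)) < length (pos b)"
      using arg_cong[OF pb(2), of length] by simp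
    then have "pos' (par b) = pos (par b) \<and> par' (par b) = par (par b)"
      using less.hyps pb(1) N_subset b lt' df_less_asym by blast
    moreover have "pos' b = pos' (par' b) @ [slot (par' b) (par' (par' b)) b]"
      using assms(2) b by (auto simp: dfs_labelling_def)
    ultimately show ?thesis using eq pb(2) by simp
  qed (use assms in \<open>auto simp: dfs_labelling_def\<close>)
qed

text \<open>Take the earliest word \<open>w\<close> of a parent, in either labelling, of a vertex
  \<open>q\<close> on whose parent they disagree. Up to \<open>w\<close> the labellings coincide, so
  the parent of \<open>q\<close> found at \<open>w\<close> sits at \<open>w\<close> in the other
  labelling as well. There the parent of \<open>q\<close> cannot come later, being the first
  neighbour, nor earlier, by minimality of \<open>w\<close>; so it is the same vertex.\<close>

lemma dfs_labelling_unique: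
  assumes "dfs_labelling pos par" "dfs_labelling pos' par'" "b \<in> V"
  shows "pos' b = pos b" "par' b = par b"
proof -
  let ?B = "{q \<in> V - {r}. par' q \<noteq> par q}"
  let ?W = "(pos \<circ> par) ` ?B \<union> (pos' \<circ> par') ` ?B"
  have "?B = {}"
  proof (rule ccontr)
    assume "?B \<noteq> {}"
    moreover have "finite ?W" using finite_V by simp
    ultimately obtain w where w: "w \<in> ?W" "\<forall>w'\<in>?W. \<not> w' \<prec>\<^sub>D\<^sub>F w"
      using df_first_exists[of ?W] by blast
    \<comment> \<open>Stated for arbitrary labellings because it is applied again with the two
      exchanged.\<close>
    have False if lab: "dfs_labelling pos par" "dfs_labelling pos' par'"
      and q: "q \<in> V - {r}" "par' q \<noteq> par q" "w = pos (par q)"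
      and w: "\<And>q. q \<in> V - {r} \<Longrightarrow> par' q \<noteq> par q \<Longrightarrow>
        \<not> pos (par q) \<prec>\<^sub>D\<^sub>F w \<and> \<not> pos' (par' q) \<prec>\<^sub>D\<^sub>F w"
      for pos par pos' par' q
    proof -
      have a: "par q \<in> N q" "par' q \<in> N q"
        using lab q(1) by (auto simp: dfs_labelling_def)
      then have V: "par q \<in> V" "par' q \<in> V" using N_subset[of q] q(1) by auto
      have "pos' (par q) = pos (par q)"
        using dfs_labelling_agree[OF lab _ V(1), of w] w q(3) by auto
      moreover have "\<not> pos' (par q) \<prec>\<^sub>D\<^sub>F pos' (par' q)"
        using lab(2) q(1) a by (auto simp: dfs_labelling_def)
      ultimately have "pos' (par q) = pos' (par' q)"
        using w[OF q(1,2)] q(3) df_less_linear by metis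
      then show False
        using lab(2) V q(2) by (auto simp: dfs_labelling_def inj_on_def)
    qed
    note contra = this
    have w': "\<not> pos (par q) \<prec>\<^sub>D\<^sub>F w \<and> \<not> pos' (par' q) \<prec>\<^sub>D\<^sub>F w"
      if "q \<in> V - {r}" "par' q \<noteq> par q" for q
    proof -
      have "pos (par q) \<in> ?W" "pos' (par' q) \<in> ?W" using that by auto
      then show ?thesis using w(2) by blast
    qed
    from w(1) obtain q where q: "q \<in> V - {r}" "par' q \<noteq> par q"
      "w = pos (par q) \<or> w = pos' (par' q)" by auto
    from q(3) show False
    proof
      assume "w = pos (par q)"
      then show False using contra[OF assms(1,2) q(1,2)] w' by blast
    next
      assume *: "w = pos' (par' q)"
      show False
        by (rule contra[OF assms(2,1) q(1) q(2)[symmetric] *]) (use w' in metis)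
    qed
  qed
  then have *: "par' q = par q" if "q \<in> V - {r}" for q using that by blast
  show "pos' b = pos b" "par' b = par b"
    using dfs_labelling_agree[OF assms(1,2) _ assms(3), of "pos b"] * by auto
qed

text \<open>\<open>X\<close> is the set of explored vertices; the discovered ones are the root and the neighbours
  of explored ones. The next vertex to explore is the first discovered one outside \<open>X\<close>.\<close>

definition partial_dfs :: "'a set \<Rightarrow> ('a \<Rightarrow> vertex) \<Rightarrow> ('a \<Rightarrow> 'a) \<Rightarrow> bool" where
  "partial_dfs X pos par \<longleftrightarrow> (let D = insert r (\<Union>(N ` X)) in
     X \<subseteq> D \<and> inj_on pos D \<and> pos r = [] \<and> par r = outside \<and>
     (\<forall>x\<in>X. \<forall>y\<in>D - X. pos x \<prec>\<^sub>D\<^sub>F pos y) \<and>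
     (\<forall>q\<in>D - {r}. par q \<in> N q \<and> par q \<in> X \<and> pos q = pos (par q) @ [slot (par q) (par (par q)) q] \<and>
       (\<forall>a\<in>N q \<inter> X. \<not> pos a \<prec>\<^sub>D\<^sub>F pos (par q))))"

text \<open>Explore the first waiting vertex \<open>y\<close>: its undiscovered neighbours receive
  \<open>y\<close> as parent and words extending that of \<open>y\<close>. As all explored vertices
  come before \<open>y\<close>, no parent assigned earlier is overtaken by \<open>y\<close>.\<close>

lemma partial_dfs_step:
  assumes X: "X \<subseteq> V" "partial_dfs X pos par" and ne: "insert r (\<Union>(N ` X)) - X \<noteq> {}"
  shows "\<exists>y pos' par'. y \<in> V - X \<and> partial_dfs (insert y X) pos' par'"
proof -
  define D where "D = insert r (\<Union>(N ` X))"
  have D: "X \<subseteq> D" "inj_on pos D" "pos r = []" "par r = outside"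
    "\<And>x y. x \<in> X \<Longrightarrow> y \<in> D - X \<Longrightarrow> pos x \<prec>\<^sub>D\<^sub>F pos y"
    and Dq: "\<And>q. q \<in> D - {r} \<Longrightarrow> par q \<in> N q \<and> par q \<in> X \<and>
       pos q = pos (par q) @ [slot (par q) (par (par q)) q]"
      "\<And>q a. q \<in> D - {r} \<Longrightarrow> a \<in> N q \<inter> X \<Longrightarrow> \<not> pos a \<prec>\<^sub>D\<^sub>F pos (par q)"
    using X(2) unfolding partial_dfs_def D_def[symmetric] Let_def by auto
  have DV: "D \<subseteq> V" using X(1) N_subset r by (auto simp: D_def)
  have "finite (D - X)" using finite_subset[OF DV finite_V] by simp
  then obtain w where w: "w \<in> pos ` (D - X)" "\<forall>w'\<in>pos ` (D - X). \<not> w' \<prec>\<^sub>D\<^sub>F w"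
    using df_first_exists[of "pos ` (D - X)"] ne unfolding D_def[symmetric] by blast
  then obtain y where y: "y \<in> D" "y \<notin> X" and wy: "w = pos y" by blast
  have min: "pos y \<prec>\<^sub>D\<^sub>F pos z" if "z \<in> D - X" "z \<noteq> y" for z
    using w(2) df_less_linear[of "pos y" "pos z"] D(2) y that unfolding wy inj_on_def by blast
  have yV: "y \<in> V" using y DV by blast
  have pary: "par y \<in> N y \<or> y = r \<and> par y = outside" using Dq(1)[of y] y D(4) by blast
  \<comment> \<open>\<open>slot_inj\<close> says nothing about the parent itself, so
    \<open>par y\<close> must not be among the new vertices.\<close>
  have pary_new: "par y \<notin> N y - D"
    using Dq(1)[of y] y D(1,4) outside N_subset[OF yV] by blast
  define new where "new = N y - D"
  define D' where "D' = insert r (\<Union>(N ` insert y X))"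
  have D': "D' = D \<union> new" by (auto simp: D'_def D_def new_def)
  define pos' where "pos' = (\<lambda>q. if q \<in> new then pos y @ [slot y (par y) q] else pos q)"
  define par' where "par' = (\<lambda>q. if q \<in> new then y else par q)"
  have old: "pos' q = pos q" "par' q = par q" if "q \<in> D" for q
    using that by (auto simp: pos'_def par'_def new_def)
  have newD: "q \<in> N y" "y \<in> N q" "pos' q = pos y @ [slot y (par y) q]" "par' q = y" "q \<noteq> r" "q \<notin> D"
    if "q \<in> new" for q
    using that N_sym[OF yV] by (auto simp: pos'_def par'_def new_def D_def)
  \<comment> \<open>An old vertex with this word would have \<open>y\<close> as parent, but parents
    are explored and \<open>y\<close> is not yet.\<close>
  have clash: "pos' q \<noteq> pos' z" if "q \<in> new" "z \<in> D" for q z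
  proof
    assume "pos' q = pos' z"
    then have *: "pos z = pos y @ [slot y (par y) q]" using newD(3) old that by simp
    then have "z \<noteq> r" using D(3) by auto
    then have "pos (par z) = pos y" "par z \<in> X" using Dq(1)[of z] that * by auto
    then show False using D(1,2) y unfolding inj_on_def by blast
  qed
  have "inj_on pos' D'"
  proof (rule inj_onI)
    fix a b assume ab: "a \<in> D'" "b \<in> D'" "pos' a = pos' b"
    consider "a \<in> D" "b \<in> D" | "a \<in> new" "b \<in> new"
      using ab clash[of a b] clash[of b a] D' by auto
    then show "a = b"
    proof cases
      case 1
      then show ?thesis using ab(3) D(2) old unfolding inj_on_def by simp
    next
      case 2
      then have "slot y (par y) a = slot y (par y) b" using ab(3) newD(3) by simp
      moreover have "a \<in> N y - {par y}" "b \<in> N y - {par y}"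
        using 2 pary_new unfolding new_def by auto
      ultimately show ?thesis using slot_inj[OF yV pary] by blast
    qed
  qed
  moreover have "pos' x \<prec>\<^sub>D\<^sub>F pos' z" if "x \<in> insert y X" "z \<in> D' - insert y X" for x z
  proof (cases "z \<in> new")
    case True
    then have "pos y \<prec>\<^sub>D\<^sub>F pos' z" using newD(3) by simp
    moreover have "pos' x = pos x" "x = y \<or> pos x \<prec>\<^sub>D\<^sub>F pos y"
      using that(1) old[of x] D(1) y D(5)[of x y] by auto
    ultimately show ?thesis using df_less_trans[of "pos x"] by auto
  next
    case False
    then show ?thesis
      using that old[of x] old[of z] D(1) y D(5)[of x z] min[of z] D' by auto
  qed
  moreover have "par' q \<in> N q \<and> par' q \<in> insert y X \<and>
      pos' q = pos' (par' q) @ [slot (par' q) (par' (par' q)) q] \<and>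
       (\<forall>a\<in>N q \<inter> insert y X. \<not> pos' a \<prec>\<^sub>D\<^sub>F pos' (par' q))" if q: "q \<in> D' - {r}" for q
  proof (cases "q \<in> new")
    case True
    have "q \<in> V" using newD(1)[OF True] N_subset[OF yV] by blast
    then have "\<forall>a\<in>N q \<inter> insert y X. a = y"
      using N_sym[of q] newD(6)[OF True] unfolding D_def by auto
    then have "\<forall>a\<in>N q \<inter> insert y X. \<not> pos' a \<prec>\<^sub>D\<^sub>F pos' y"
      using df_less_irrefl by metis
    then show ?thesis
      by (simp only: newD[OF True] old[OF y(1)]) simp
  next
    case False
    then have qD: "q \<in> D - {r}" using q D' by blast
    have "par q \<in> D" using Dq(1)[OF qD] D(1) by blast
    moreover have "\<not> pos' a \<prec>\<^sub>D\<^sub>F pos' (par' q)" if "a \<in> N q \<inter> insert y X" for a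
    proof -
      have "a \<in> D" using that D(1) y by blast
      moreover have "\<not> pos a \<prec>\<^sub>D\<^sub>F pos (par q)"
        using that Dq(2)[OF qD, of a] Dq(1)[OF qD] D(5)[of "par q" y] y df_less_asym by blast
      ultimately show ?thesis
        using old(1)[of a] old(2)[of q] old(1)[of "par q"] \<open>par q \<in> D\<close> qD by simp
    qed
    ultimately show ?thesis using Dq(1)[OF qD] old[of q] old[of "par q"] qD by simp
  qed
  moreover have "insert y X \<subseteq> D'" "pos' r = []" "par' r = outside"
    using D y D' old[of r] by (auto simp: D_def)
  ultimately have "partial_dfs (insert y X) pos' par'"
    unfolding partial_dfs_def D'_def[symmetric] Let_def by blast
  then show ?thesis using y(2) yV by blast
qed

text \<open>Induction on the number of explored vertices. While some vertex is unexplored,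
  connectivity provides a waiting one: otherwise \<open>X\<close> would contain the root and all
  neighbours of its elements. Once \<open>X = V\<close>, the invariant becomes
  \<open>dfs_labelling\<close>.\<close>

lemma dfs_labelling_exists: "\<exists>pos par. dfs_labelling pos par"
proof -
  have "\<exists>X pos par. X \<subseteq> V \<and> card X = n \<and> partial_dfs X pos par" if "n \<le> card V" for n
    using that
  proof (induction n)
    case 0
    have "partial_dfs {} (\<lambda>_. []) (\<lambda>_. outside)"
      by (simp add: partial_dfs_def)
    then show ?case by (intro exI[of _ "{}"]) auto
  next
    case (Suc n)
    then obtain X pos par where X: "X \<subseteq> V" "card X = n" "partial_dfs X pos par" by auto
    have "insert r (\<Union>(N ` X)) - X \<noteq> {}"
    proof
      assume "insert r (\<Union>(N ` X)) - X = {}"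
      then have "X = V" using X(1) by (intro connected) auto
      then show False using X(2) Suc.prems by simp
    qed
    from partial_dfs_step[OF X(1,3) this] obtain y pos' par'
      where "y \<in> V - X" "partial_dfs (insert y X) pos' par'" by blast
    moreover from this have "card (insert y X) = Suc n" "insert y X \<subseteq> V"
      using X finite_subset[OF X(1) finite_V] by auto
    ultimately show ?case by blast
  qed
  then obtain X pos par where X: "X \<subseteq> V" "card X = card V" "partial_dfs X pos par" by blast
  then have XV: "X = V" using finite_V card_subset_eq by blast
  have "insert r (\<Union>(N ` V)) = V" using r N_subset X(3) XV
    by (auto simp: partial_dfs_def Let_def)
  moreover have "N q \<inter> V = N q" if "q \<in> V" for q using N_subset[OF that] by blast
  ultimately have "dfs_labelling pos par"
    using X(3) unfolding XV partial_dfs_def dfs_labelling_def Let_def by auto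
  then show ?thesis by blast
qed

end

section \<open>The glued graph\<close>

lemma downward_closed_eq_lessThan:
  fixes A :: "nat set"
  assumes "finite A" "\<And>i j. i \<in> A \<Longrightarrow> j < i \<Longrightarrow> j \<in> A"
  shows "A = {..<card A}"
proof (cases "A = {}")
  case False
  have "A = {..Max A}"
  proof (intro equalityI subsetI)
    show "j \<in> A" if "j \<in> {..Max A}" for j
      using that assms(2)[of "Max A" j] Max_in[OF assms(1) False] by (cases "j = Max A") auto
  qed (use assms(1) in auto)
  then show ?thesis by (metis card_atMost lessThan_Suc_atMost)
qed auto

lemma plane_treeD:
  assumes "plane_tree t"
  shows "finite t" "[] \<in> t" "u @ [i] \<in> t \<Longrightarrow> u \<in> t" "u @ [i] \<in> t \<Longrightarrow> j < i \<Longrightarrow> u @ [j] \<in> t"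
proof -
  note * = assms[unfolded plane_tree_def]
  show "finite t" "[] \<in> t" by (rule *[THEN conjunct1], rule *[THEN conjunct2, THEN conjunct1])
  assume "u @ [i] \<in> t"
  note h = *[THEN conjunct2, THEN conjunct2, rule_format, OF this]
  show "u \<in> t" using h by (rule conjunct1)
  show "u @ [j] \<in> t" if "j < i" using h[THEN conjunct2] that by (elim allE impE)
qed

lemma plane_tree_parent: "plane_tree t \<Longrightarrow> w \<in> t \<Longrightarrow> parent w \<in> t"
  using plane_treeD(3)[of t "parent w" "last w"] by (cases "w = []") auto

lemma snoc_in_plane_tree_iff:
  assumes "plane_tree t"
  shows "w @ [i] \<in> t \<longleftrightarrow> i < num_children t w"
proof -
  have "finite ((\<lambda>i. w @ [i]) -` t)"
    using plane_treeD(1)[OF assms] by (rule finite_vimageI) (simp add: inj_def)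
  then have "finite {i. w @ [i] \<in> t}" by (simp add: vimage_def)
  then have "{i. w @ [i] \<in> t} = {..<num_children t w}"
    unfolding num_children_def using plane_treeD(4)[OF assms]
    by (intro downward_closed_eq_lessThan) auto
  then show ?thesis by auto
qed

definition removed :: "(vertex \<times> vertex) set \<Rightarrow> vertex set" where
  "removed x = fst ` x \<union> snd ` x"

text \<open>The edge of the glued graph that starts at \<open>parent y\<close> in the direction of the child \<open>y\<close>
  ends at \<open>far_end x y\<close>.\<close>

definition far_end :: "(vertex \<times> vertex) set \<Rightarrow> vertex \<Rightarrow> vertex" where
  "far_end x y = (if y \<in> fst ` x then parent (THE v. (y, v) \<in> x)
     else if y \<in> snd ` x then parent (THE u. (u, y) \<in> x) else y)"

lemma far_end:
  assumes "gluing t x"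
  shows "(u, v) \<in> x \<Longrightarrow> far_end x u = parent v"
    and "(u, v) \<in> x \<Longrightarrow> far_end x v = parent u"
    and "y \<notin> removed x \<Longrightarrow> far_end x y = y"
proof -
  assume uv: "(u, v) \<in> x"
  have "(THE v. (u, v) \<in> x) = v" "(THE u. (u, v) \<in> x) = u"
    using gluing_inj(1)[OF assms uv] uv by (auto intro!: the_equality)
  moreover have "u \<in> fst ` x" "v \<in> snd ` x" using uv by force+
  moreover have "fst ` x \<inter> snd ` x = {}" using assms by (simp add: gluing_def)
  ultimately show "far_end x u = parent v" "far_end x v = parent u"
    unfolding far_end_def by auto
qed (simp add: far_end_def removed_def)

lemma removed_cases:
  assumes "y \<in> removed x"
  obtains v where "(y, v) \<in> x" | u where "(u, y) \<in> x"
  using assms unfolding removed_def by force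

lemma removed_subset_leaves: "gluing t x \<Longrightarrow> removed x \<subseteq> leaves t"
  using gluingD(1,2) by (auto elim!: removed_cases)

lemma card_removed:
  assumes "gluing t x"
  shows "finite (removed x)" "card (removed x) = 2 * card x"
proof -
  have *: "finite x" "inj_on fst x" "inj_on snd x" "fst ` x \<inter> snd ` x = {}"
    using assms by (simp_all add: gluing_def)
  then show "finite (removed x)" by (simp add: removed_def)
  show "card (removed x) = 2 * card x"
    unfolding removed_def using * by (simp add: card_Un_disjoint card_image)
qed

text \<open>The first components get the odd offsets from \<open>m\<close> and the second ones the
  even offsets, so together they fill an interval.\<close>

lemma image_removed:
  assumes "gluing t x"
    and l: "\<And>j. j < card x \<Longrightarrow> lab (fst (ordered_list x ! j)) = m + 2 * j + 1"
      "\<And>j. j < card x \<Longrightarrow> lab (snd (ordered_list x ! j)) = m + 2 * j + 2"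
  shows "lab ` removed x = {m + 1..m + 2 * card x}"
proof -
  let ?ps = "ordered_list x" and ?k = "card x"
  have x: "x = (\<lambda>j. ?ps ! j) ` {..<?k}"
    using gluing_ordered_list[OF assms(1)] by (auto simp: set_conv_nth)
  have "lab ` removed x = (\<lambda>j. lab (fst (?ps ! j))) ` {..<?k} \<union> (\<lambda>j. lab (snd (?ps ! j))) ` {..<?k}"
    unfolding removed_def by (subst (1 2) x) (simp add: image_Un image_image)
  also have "\<dots> = (\<lambda>j. m + 2 * j + 1) ` {..<?k} \<union> (\<lambda>j. m + 2 * j + 2) ` {..<?k}"
    using l by (intro arg_cong2[of _ _ _ _ "(\<union>)"] image_cong) auto
  also have "\<dots> = {m + 1..m + 2 * ?k}"
  proof (intro equalityI subsetI)
    fix n assume n: "n \<in> {m + 1..m + 2 * ?k}"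
    show "n \<in> (\<lambda>j. m + 2 * j + 1) ` {..<?k} \<union> (\<lambda>j. m + 2 * j + 2) ` {..<?k}"
    proof (cases "even (n - m)")
      case True
      then obtain j where "n - m = 2 * j" by blast
      \<comment> \<open>The even offsets start at 2, hence the shift of the index.\<close>
      then have "n = m + 2 * (j - 1) + 2" "j - 1 < ?k" using n by auto
      then show ?thesis by blast
    next
      case False
      then obtain j where "n - m = 2 * j + 1" by (rule oddE)
      then have "n = m + 2 * j + 1" "j < ?k" using n by auto
      then show ?thesis by blast
    qed
  qed auto
  finally show ?thesis .
qed

definition neighbours :: "graph \<Rightarrow> nat \<Rightarrow> nat set" where
  "neighbours G j = {q. {j, q} \<in> snd G}"

lemma graph_degree_eq_card_neighbours:
  assumes "simple_graph G"
  shows "graph_degree G j = card (neighbours G j)"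
proof -
  have "bij_betw (\<lambda>q. {j, q}) (neighbours G j) {e \<in> snd G. j \<in> e}"
  proof (rule bij_betw_imageI)
    show "inj_on (\<lambda>q. {j, q}) (neighbours G j)"
      by (auto simp: inj_on_def doubleton_eq_iff)
    show "(\<lambda>q. {j, q}) ` neighbours G j = {e \<in> snd G. j \<in> e}"
    proof (intro equalityI subsetI)
      fix e assume e: "e \<in> {e \<in> snd G. j \<in> e}"
      then have "card e = 2" using assms by (auto simp: simple_graph_def)
      then obtain q where "e = {j, q}" using e by (auto simp: card_2_iff)
      then show "e \<in> (\<lambda>q. {j, q}) ` neighbours G j" using e by (auto simp: neighbours_def)
    qed (auto simp: neighbours_def)
  qed
  then show ?thesis
    by (auto simp: graph_degree_def split_beta dest: bij_betw_same_card)
qed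

text \<open>One fixed degree sequence, subject to conditions (1) and (3) of the theorem. Uniformity
  is exact at every such \<open>m\<close>.\<close>

locale degree_sequence =
  fixes k m :: nat and d :: "nat \<Rightarrow> nat"
  assumes m_pos: "m \<ge> 1"
    and d_pos: "j \<in> {1..m} \<Longrightarrow> d j \<ge> 1"
    and d_first: "d 1 = 1"
    and d_sum: "(\<Sum>j = 1..m. d j) = 2 * (m - 1) + 2 * k"
begin

definition glued :: "tree \<Rightarrow> (vertex \<times> vertex) set \<Rightarrow> (vertex \<Rightarrow> nat) \<Rightarrow> graph" where
  "glued t x lab = attach_and_unroot 1 (glued_graph t lab x)"

abbreviation graphs :: "graph set" where
  "graphs \<equiv> connected_graphs_with_degrees m d"

lemma sum_child_seq:
  assumes "m \<ge> 2"
  shows "(\<Sum>j\<in>{2..m}. d j - 1) + 1 = m - 1 + 2 * k"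
proof -
  have "d j - 1 + 1 = d j" if "j \<in> {2..m}" for j using d_pos[of j] that by simp
  then have "(\<Sum>j\<in>{2..m}. d j - 1) + (\<Sum>j\<in>{2..m}. 1) = (\<Sum>j\<in>{2..m}. d j)"
    unfolding sum.distrib[symmetric] by (intro sum.cong refl)
  moreover have "(\<Sum>j = 1..m. d j) = d 1 + (\<Sum>j\<in>{2..m}. d j)"
    using m_pos by (simp add: sum.atLeast_Suc_atMost numeral_2_eq_2)
  ultimately show ?thesis using d_sum d_first assms by simp
qed

abbreviation marked_trees :: "(tree \<times> (vertex \<times> vertex) set) set" where
  "marked_trees \<equiv> ordered_trees_with_collections (child_counts k m d) k"

end

section \<open>The graph glued from a marked tree: neighbourhoods, degrees, connectivity\<close>

locale glued_tree = degree_sequence +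
  fixes t :: tree and x :: "(vertex \<times> vertex) set" and lab :: "vertex \<Rightarrow> nat"
  assumes marked: "(t, x) \<in> marked_trees"
    and lab: "lab \<in> labelings m d t (ordered_list x)"
begin

abbreviation "kept \<equiv> t - removed x"

lemma plane: "plane_tree t" and gluing: "gluing t x" and card_x: "card x = k"
  using marked by (auto simp: ordered_trees_with_collections_iff trees_with_counts_def)

lemma lab_removed: "lab ` removed x = {m + 1..m + 2 * k}"
  using image_removed[OF gluing, of lab m] lab gluing_ordered_list(4)[OF gluing] card_x
  by (simp add: labelings_def)

lemma bij_lab: "bij_betw lab t {2..m + 2 * k}"
  using lab gluing_ordered_list(4)[OF gluing] card_x by (auto simp: labelings_def)

lemma removed_t: "removed x \<subseteq> t"
  using removed_subset_leaves[OF gluing] by (auto simp: leaves_def)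

lemma m_ge_2: "m \<ge> 2"
proof -
  have "m \<noteq> 1"
  proof
    assume "m = 1"
    then have "1 = 2 * k" using d_sum d_first by simp
    then show False by presburger
  qed
  then show ?thesis using m_pos by simp
qed

lemma bij_lab_kept: "bij_betw lab kept {2..m}"
proof -
  have "bij_betw lab (removed x) {m + 1..m + 2 * k}"
    by (rule bij_betw_subset[OF bij_lab removed_t lab_removed])
  then have "bij_betw lab kept ({2..m + 2 * k} - {m + 1..m + 2 * k})"
    using m_pos by (intro bij_betw_DiffI[OF bij_lab _ removed_t]) auto
  moreover have "{2..m + 2 * k} - {m + 1..m + 2 * k} = {2..m}" using m_pos by auto
  ultimately show ?thesis by simp
qed

lemma inj_lab: "w \<in> kept \<Longrightarrow> w' \<in> kept \<Longrightarrow> lab w = lab w' \<longleftrightarrow> w = w'"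
  using bij_lab_kept by (auto simp: bij_betw_def inj_on_def)

lemma lab_kept: "w \<in> kept \<Longrightarrow> lab w \<in> {2..m}"
  using bij_lab_kept bij_betwE by blast

lemma lab_surj: "j \<in> {2..m} \<Longrightarrow> \<exists>w\<in>kept. lab w = j"
  using bij_lab_kept by (metis bij_betw_def imageE)

lemma num_children_kept: "w \<in> kept \<Longrightarrow> num_children t w = d (lab w) - 1"
  using lab lab_kept[of w] by (auto simp: labelings_def)

lemma child_iff: "w \<in> kept \<Longrightarrow> w @ [i] \<in> t \<longleftrightarrow> i < d (lab w) - 1"
  using snoc_in_plane_tree_iff[OF plane] num_children_kept by auto

lemma parent_kept: "w \<in> t \<Longrightarrow> w \<noteq> [] \<Longrightarrow> parent w \<in> kept"
proof -
  assume w: "w \<in> t" "w \<noteq> []"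
  then have "num_children t (parent w) \<noteq> 0"
    using snoc_in_plane_tree_iff[OF plane, of "parent w" "last w"] by auto
  then show ?thesis
    using removed_subset_leaves[OF gluing] plane_tree_parent[OF plane w(1)] by (auto simp: leaves_def)
qed

lemma root_kept: "[] \<in> kept"
  using plane gluingD(6,7)[OF gluing] by (auto simp: plane_tree_def elim!: removed_cases)

lemma removed_parent:
  assumes "(u, v) \<in> x"
  shows "parent u \<in> kept" "parent v \<in> kept" "u \<in> t" "v \<in> t" "u \<notin> kept" "v \<notin> kept"
    "u = parent u @ [last u]" "v = parent v @ [last v]"
  using assms gluingD[OF gluing assms] parent_kept by (auto simp: leaves_def removed_def rev_image_eqI)

lemma far_end_kept: "w \<in> t \<Longrightarrow> w \<noteq> [] \<Longrightarrow> far_end x w \<in> kept"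
  by (metis Diff_iff far_end[OF gluing] removed_cases removed_parent(1,2))

text \<open>The edges at a kept vertex are one edge up, which leads to vertex 1 at the root, and one
  edge \<open>down w i\<close> for each child position. A tree edge is up at its lower end and down
  at its upper end; a glued edge is down at both ends.\<close>

definition up :: "vertex \<Rightarrow> nat" where
  "up w = (if w = [] then 1 else lab (parent w))"

definition down :: "vertex \<Rightarrow> nat \<Rightarrow> nat" where
  "down w i = lab (far_end x (w @ [i]))"

lemma fst_glued: "fst (glued t x lab) = {1..m}"
  using bij_lab_kept m_pos
  by (auto simp: glued_def attach_and_unroot_def glued_graph_def Let_def removed_def[symmetric] bij_betw_def)

lemma edges_glued:
  "snd (glued t x lab) = {{lab w, up w} | w. w \<in> kept} \<union> {{lab (parent u), lab (parent v)} | u v. (u, v) \<in> x}"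
proof -
  have "{{lab w, up w} | w. w \<in> kept} = insert {1, lab []} {{lab (parent w), lab w} | w. w \<in> kept \<and> w \<noteq> []}"
    using root_kept by (auto simp: up_def insert_commute)
  then show ?thesis
    by (simp add: glued_def attach_and_unroot_def glued_graph_def Let_def removed_def[symmetric])
qed

lemma up_neq: "w \<in> kept \<Longrightarrow> up w \<in> {1..m} \<and> up w \<noteq> lab w"
  using parent_kept[of w] inj_lab[of w "parent w"] lab_kept[of "parent w"] lab_kept[of w]
    df_less_parent[of w] m_pos by (auto simp: up_def)

lemma neighbours_lab:
  assumes w: "w \<in> kept"
  shows "neighbours (glued t x lab) (lab w) = insert (up w) (down w ` {..<d (lab w) - 1})"
proof (intro equalityI subsetI)
  fix q assume "q \<in> neighbours (glued t x lab) (lab w)"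
  then have "{lab w, q} \<in> snd (glued t x lab)" by (simp add: neighbours_def)
  then consider w' where "w' \<in> kept" "{lab w, q} = {lab w', up w'}"
    | u v where "(u, v) \<in> x" "{lab w, q} = {lab (parent u), lab (parent v)}"
    unfolding edges_glued by blast
  then show "q \<in> insert (up w) (down w ` {..<d (lab w) - 1})"
  proof cases
    case 1
    show ?thesis
    proof (cases "lab w = lab w'")
      case True
      then show ?thesis using 1 inj_lab[OF w 1(1)] by (auto simp: doubleton_eq_iff)
    next
      case False
      then have *: "lab w = up w'" "q = lab w'" using 1 by (auto simp: doubleton_eq_iff)
      then have ne: "w' \<noteq> []" using lab_kept[OF w] by (auto simp: up_def)
      then have "w = parent w'" using * inj_lab[OF w] parent_kept[of w'] 1(1) by (auto simp: up_def)
      then have "w @ [last w'] = w'" using ne by simp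
      then have "q = down w (last w')" "last w' < d (lab w) - 1"
        using * 1(1) far_end(3)[OF gluing, of w'] child_iff[OF w, of "last w'"] by (auto simp: down_def)
      then show ?thesis by blast
    qed
  next
    case 2
    note uv = removed_parent[OF 2(1)] far_end(1,2)[OF gluing 2(1)]
    have "w = parent u \<and> q = lab (parent v) \<or> w = parent v \<and> q = lab (parent u)"
      using 2(2) inj_lab[OF w] uv(1,2) by (auto simp: doubleton_eq_iff)
    then have "q = down w (last u) \<and> last u < d (lab w) - 1 \<or> q = down w (last v) \<and> last v < d (lab w) - 1"
      using uv child_iff[OF w] unfolding down_def by metis
    then show ?thesis by blast
  qed
next
  fix q assume "q \<in> insert (up w) (down w ` {..<d (lab w) - 1})"
  then consider "q = up w" | i where "i < d (lab w) - 1" "q = down w i" by auto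
  then have "{lab w, q} \<in> snd (glued t x lab)"
  proof cases
    case 1
    then show ?thesis using w unfolding edges_glued by blast
  next
    case 2
    let ?y = "w @ [i]"
    have y: "?y \<in> t" using 2 child_iff[OF w] by simp
    show ?thesis
    proof (cases "?y \<in> removed x")
      case True
      then show ?thesis
      proof (cases rule: removed_cases)
        case (1 v)
        then have "{lab w, q} = {lab (parent ?y), lab (parent v)}"
          using 2 far_end(1)[OF gluing 1] by (simp add: down_def)
        then show ?thesis using 1 unfolding edges_glued by blast
      next
        case (2 u)
        then have "{lab w, q} = {lab (parent u), lab (parent ?y)}"
          using \<open>q = down w i\<close> far_end(2)[OF gluing 2] by (auto simp: down_def)
        then show ?thesis using 2 unfolding edges_glued by blast
      qed
    next
      case False
      then have "{lab w, q} = {lab ?y, up ?y}"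
        using 2 far_end(3)[OF gluing False] by (auto simp: down_def up_def)
      moreover have "?y \<in> kept" using False y by simp
      ultimately show ?thesis unfolding edges_glued by blast
    qed
  qed
  then show "q \<in> neighbours (glued t x lab) (lab w)" by (simp add: neighbours_def)
qed

text \<open>No glued edge runs parallel to the edge to the parent: from \<open>w\<close> it leads
  either to a vertex after \<open>w\<close> or, by admissibility, to one strictly after
  \<open>parent w\<close>.\<close>

lemma down_neq_up:
  assumes w: "w \<in> kept" "i < d (lab w) - 1"
  shows "down w i \<noteq> up w"
proof
  assume eq: "down w i = up w"
  let ?y = "w @ [i]"
  have y: "?y \<in> t" "far_end x ?y \<in> kept" using w child_iff far_end_kept by auto
  then have ne: "w \<noteq> []" using eq lab_kept[OF y(2)] by (auto simp: up_def down_def)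
  then have *: "far_end x ?y = parent w"
    using eq inj_lab[OF y(2) parent_kept[of w]] w by (auto simp: up_def down_def)
  show False
  proof (cases "?y \<in> removed x")
    case True
    then show False
    proof (cases rule: removed_cases)
      case (1 v)
      then show ?thesis
        using * far_end(1)[OF gluing 1] gluingD(5)[OF gluing 1] df_less_parent[OF ne] df_less_asym by auto
    next
      case (2 u)
      then show ?thesis
        using * far_end(2)[OF gluing 2] gluingD(4)[OF gluing 2] by auto
    qed
  next
    case False
    then have "w @ [i] = parent w" using * far_end(3)[OF gluing False] by simp
    from arg_cong[OF this, of length] show False by simp
  qed
qed

text \<open>Two positions with the same far end would form a double edge. A glued edge to a child of
  \<open>w\<close> would break admissibility from either side, two glued edges of opposite
  directions would order their ends both ways, and two of the same direction have equal parents,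
  which \<open>gluing\<close> forbids.\<close>

lemma inj_down:
  assumes w: "w \<in> kept"
  shows "inj_on (down w) {..<d (lab w) - 1}"
proof (rule inj_onI)
  fix i j assume ij: "i \<in> {..<d (lab w) - 1}" "j \<in> {..<d (lab w) - 1}" "down w i = down w j"
  then have in_t: "w @ [i] \<in> t" "w @ [j] \<in> t" using child_iff[OF w] by auto
  then have eq: "far_end x (w @ [i]) = far_end x (w @ [j])"
    using ij(3) inj_lab[OF far_end_kept far_end_kept] by (auto simp: down_def)
  have far: "far_end x (w @ [i]) = w @ [i] \<or> (\<exists>v. (w @ [i], v) \<in> x \<and> far_end x (w @ [i]) = parent v)
      \<or> (\<exists>u. (u, w @ [i]) \<in> x \<and> far_end x (w @ [i]) = parent u)" for i
    using far_end[OF gluing] by (metis removed_cases)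
  have down_left: False if "(w @ [i], v) \<in> x" "w @ [j] = parent v" for i j v
    using gluingD(4)[OF gluing that(1)] that(2)[symmetric] by auto
  have down_right: False if "(u, w @ [i]) \<in> x" "w @ [j] = parent u" for i j u
    using gluingD(5)[OF gluing that(1)] that(2)[symmetric] df_less_asym[of w "w @ [j]"] by auto
  have left_right: False if "(w @ [i], v) \<in> x" "(u, w @ [j]) \<in> x" "parent v = parent u" for i j u v
    using gluingD(5)[OF gluing that(1)] gluingD(5)[OF gluing that(2)] that(3) df_less_asym by auto
  have left: "i = j" if "(w @ [i], v) \<in> x" "(w @ [j], v') \<in> x" "parent v = parent v'" for v v'
    using gluing_inj(3)[OF gluing that(1,2)] that(3) by auto
  have right: "i = j" if "(u, w @ [i]) \<in> x" "(u', w @ [j]) \<in> x" "parent u = parent u'" for u u'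
    using gluing_inj(3)[OF gluing that(1,2)] that(3) by auto
  show "i = j"
    using far[of i] far[of j] eq down_left down_right left_right left right by (metis same_append_eq list.inject)
qed

lemma card_neighbours_lab: "w \<in> kept \<Longrightarrow> card (neighbours (glued t x lab) (lab w)) = d (lab w)"
proof -
  assume w: "w \<in> kept"
  have "up w \<notin> down w ` {..<d (lab w) - 1}" using down_neq_up[OF w] by fastforce
  moreover have "1 \<le> d (lab w)" using d_pos lab_kept[OF w] by auto
  ultimately show ?thesis
    using card_image[OF inj_down[OF w]] by (simp add: neighbours_lab[OF w])
qed

lemma down_bij:
  "w \<in> kept \<Longrightarrow> bij_betw (down w) {..<d (lab w) - 1} (neighbours (glued t x lab) (lab w) - {up w})"
proof -
  assume w: "w \<in> kept"
  have "up w \<notin> down w ` {..<d (lab w) - 1}" using down_neq_up[OF w] by fastforce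
  then show ?thesis
    using inj_down[OF w] by (simp add: neighbours_lab[OF w] bij_betw_def)
qed

lemma simple_glued: "simple_graph (glued t x lab)"
proof -
  have "e \<subseteq> {1..m} \<and> card e = 2" if "e \<in> snd (glued t x lab)" for e
    using that unfolding edges_glued
  proof
    assume "e \<in> {{lab w, up w} | w. w \<in> kept}"
    then show ?thesis using up_neq lab_kept by (force simp: card_insert_if)
  next
    assume "e \<in> {{lab (parent u), lab (parent v)} |u v. (u, v) \<in> x}"
    then obtain u v where uv: "e = {lab (parent u), lab (parent v)}" "(u, v) \<in> x" by blast
    then have "lab (parent u) \<noteq> lab (parent v)"
      using gluingD(5)[OF gluing uv(2)] inj_lab[OF removed_parent(1,2)[OF uv(2)]] by auto
    then show ?thesis using uv lab_kept removed_parent(1,2)[OF uv(2)] by force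
  qed
  then show ?thesis using fst_glued by (simp add: simple_graph_def split_beta)
qed

lemma neighbours_first: "neighbours (glued t x lab) 1 = {lab []}"
proof -
  have "{1, q} \<in> snd (glued t x lab) \<longleftrightarrow> q = lab []" for q
  proof
    assume "{1, q} \<in> snd (glued t x lab)"
    then consider w where "w \<in> kept" "{1, q} = {lab w, up w}"
      | u v where "(u, v) \<in> x" "{1, q} = {lab (parent u), lab (parent v)}"
      unfolding edges_glued by blast
    then show "q = lab []"
    proof cases
      case 1
      then have "up w = 1" "q = lab w" using lab_kept[of w] by (auto simp: doubleton_eq_iff)
      then show ?thesis using lab_kept[OF parent_kept[of w]] 1(1) by (auto simp: up_def split: if_splits)
    next
      case 2
      then show ?thesis
        using lab_kept[OF removed_parent(1)[OF 2(1)]] lab_kept[OF removed_parent(2)[OF 2(1)]]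
        by (auto simp: doubleton_eq_iff)
    qed
  next
    assume "q = lab []"
    then show "{1, q} \<in> snd (glued t x lab)"
      using root_kept unfolding edges_glued by (auto simp: up_def)
  qed
  then show ?thesis by (auto simp: neighbours_def)
qed

lemma connected_glued: "connected_graph (glued t x lab)"
proof -
  let ?R = "{(a, b). {a, b} \<in> snd (glued t x lab)}\<^sup>*"
  have sym: "(a, b) \<in> ?R \<Longrightarrow> (b, a) \<in> ?R" for a b
    by (rule symD[OF sym_rtrancl]) (auto simp: sym_def insert_commute)
  have up: "(lab w, up w) \<in> ?R" if "w \<in> kept" for w
    using that unfolding edges_glued by blast
  have to_1: "(lab w, 1) \<in> ?R" if "w \<in> kept" for w
    using that
  proof (induction w rule: rev_induct)
    case Nil
    then show ?case using up[of "[]"] by (simp add: up_def)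
  next
    case (snoc i w)
    then have "w \<in> kept" using parent_kept[of "w @ [i]"] by auto
    then show ?case using snoc up[of "w @ [i]"] by (auto simp: up_def intro: rtrancl_trans)
  qed
  have "(a, 1) \<in> ?R" if "a \<in> {1..m}" for a
    using that to_1 lab_surj[of a] by (cases "a = 1") auto
  then have "(a, b) \<in> ?R" if "a \<in> {1..m}" "b \<in> {1..m}" for a b
    using rtrancl_trans[of a 1 _ b] sym[of b 1] that by blast
  then show ?thesis using m_pos fst_glued by (auto simp: connected_graph_def split_beta)
qed

lemma glued_in_graphs: "glued t x lab \<in> graphs"
proof -
  have "graph_degree (glued t x lab) j = d j" if j: "j \<in> {1..m}" for j
  proof (cases "j = 1")
    case True
    then show ?thesis
      using graph_degree_eq_card_neighbours[OF simple_glued] neighbours_first d_first by simp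
  next
    case False
    then obtain w where "w \<in> kept" "j = lab w" using lab_surj[of j] j by auto
    then show ?thesis
      using graph_degree_eq_card_neighbours[OF simple_glued] card_neighbours_lab by simp
  qed
  then show ?thesis
    using fst_glued simple_glued connected_glued by (simp add: connected_graphs_with_degrees_def)
qed

end

text \<open>The labels of removed vertices are dictated by their places in
  \<open>ordered_list x\<close>, so only a labelling \<open>f\<close> of the kept vertices has to be
  supplied.\<close>

lemma labelings_extend:
  assumes x: "gluing t x" "removed x \<subseteq> t"
    and f: "bij_betw f (t - removed x) {2..m}" "\<And>w. w \<in> t - removed x \<Longrightarrow> num_children t w = d (f w) - 1"
    and m: "m \<ge> 1"
  shows "\<exists>lab\<in>labelings m d t (ordered_list x). \<forall>w\<in>t - removed x. lab w = f w"
proof -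
  let ?ps = "ordered_list x"
  note ps = gluing_ordered_list[OF x(1)]
  define lab where "lab = restrict (\<lambda>w. if w \<in> fst ` x then m + 2 * (THE j. j < card x \<and> fst (?ps ! j) = w) + 1
    else if w \<in> snd ` x then m + 2 * (THE j. j < card x \<and> snd (?ps ! j) = w) + 2 else f w) t"
  have nth: "?ps ! j \<in> x" if "j < card x" for j
    using that ps(1,4) nth_mem by metis
  have uniq: "i = j" if "i < card x" "j < card x" "fst (?ps ! i) = fst (?ps ! j) \<or> snd (?ps ! i) = snd (?ps ! j)" for i j
  proof -
    have "?ps ! i = ?ps ! j"
      using nth[OF that(1)] nth[OF that(2)] that(3) x(1) by (auto simp: gluing_def dest: inj_onD)
    then show ?thesis using that(1,2) ps(3,4) by (simp add: nth_eq_iff_index_eq)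
  qed
  have removed_t: "fst (?ps ! j) \<in> t" "snd (?ps ! j) \<in> t" "fst (?ps ! j) \<in> fst ` x"
    "snd (?ps ! j) \<in> snd ` x" "snd (?ps ! j) \<notin> fst ` x" if "j < card x" for j
  proof -
    show *: "fst (?ps ! j) \<in> fst ` x" "snd (?ps ! j) \<in> snd ` x" using nth[OF that] by auto
    then show "fst (?ps ! j) \<in> t" "snd (?ps ! j) \<in> t" using x(2) by (auto simp: removed_def)
    show "snd (?ps ! j) \<notin> fst ` x" using *(2) x(1) by (auto simp: gluing_def)
  qed
  have "(THE i. i < card x \<and> fst (?ps ! i) = fst (?ps ! j)) = j"
    "(THE i. i < card x \<and> snd (?ps ! i) = snd (?ps ! j)) = j" if "j < card x" for j
    using that uniq by (auto intro!: the_equality)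
  then have l: "lab (fst (?ps ! j)) = m + 2 * j + 1" "lab (snd (?ps ! j)) = m + 2 * j + 2"
    if "j < card x" for j
    using removed_t[OF that] that by (simp_all add: lab_def)
  have lab_f: "lab w = f w" if "w \<in> t - removed x" for w
    using that by (auto simp: lab_def removed_def)
  have img: "lab ` removed x = {m + 1..m + 2 * card x}"
    using image_removed[OF x(1), of lab m] l by blast
  then have "inj_on lab (removed x)"
    using card_removed[OF x(1)] by (intro eq_card_imp_inj_on) simp_all
  with img have "bij_betw lab (removed x) {m + 1..m + 2 * card x}" by (simp add: bij_betw_def)
  moreover have "bij_betw lab (t - removed x) {2..m}"
    using f(1) lab_f bij_betw_cong[of "t - removed x" lab f "{2..m}"] by blast
  ultimately have "bij_betw lab ((t - removed x) \<union> removed x) ({2..m} \<union> {m + 1..m + 2 * card x})"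
    by (intro bij_betw_combine) auto
  moreover have "(t - removed x) \<union> removed x = t" using x(2) by blast
  moreover have "{2..m} \<union> {m + 1..m + 2 * card x} = {2..m + 2 * card x}" using m by auto
  ultimately have "bij_betw lab t {2..m + 2 * length ?ps}" using ps(4) by simp
  moreover have "num_children t w = d (lab w) - 1" if "w \<in> t" "lab w \<le> m" for w
  proof -
    have "w \<notin> removed x"
      using imageI[of w "removed x" lab] that(2) unfolding img by auto
    then show ?thesis using f(2)[of w] lab_f[of w] that(1) by simp
  qed
  moreover have "lab \<in> extensional t" by (simp add: lab_def)
  ultimately have "lab \<in> labelings m d t ?ps" using l ps(4) by (simp add: labelings_def)
  then show ?thesis using lab_f by blast
qed

section \<open>Exploration data of a graph with the given degrees\<close>

locale target_graph = degree_sequence +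
  fixes G :: graph
  assumes G: "G \<in> graphs" and m_ge: "m \<ge> 2"
begin

abbreviation "verts \<equiv> {2..m}"

lemma simple_G: "simple_graph G" and fst_G: "fst G = {1..m}"
  using G by (auto simp: connected_graphs_with_degrees_def)

lemma neighbours_G:
  shows "neighbours G j \<subseteq> {1..m}" "q \<in> neighbours G j \<longleftrightarrow> j \<in> neighbours G q" "j \<notin> neighbours G j"
    "finite (neighbours G j)"
proof -
  have *: "e \<subseteq> {1..m} \<and> card e = 2" if "e \<in> snd G" for e
    using that simple_G fst_G by (auto simp: simple_graph_def split_beta)
  then show "neighbours G j \<subseteq> {1..m}" "j \<notin> neighbours G j" by (fastforce simp: neighbours_def)+
  then show "finite (neighbours G j)" using finite_subset by blast
  show "q \<in> neighbours G j \<longleftrightarrow> j \<in> neighbours G q" by (simp add: neighbours_def insert_commute)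
qed

lemma card_neighbours_G: "j \<in> {1..m} \<Longrightarrow> card (neighbours G j) = d j"
  using G graph_degree_eq_card_neighbours[OF simple_G] by (simp add: connected_graphs_with_degrees_def)

definition root :: nat where
  "root = the_elem (neighbours G 1)"

lemma neighbours_1: "neighbours G 1 = {root}"
proof -
  have "card (neighbours G 1) = 1" using card_neighbours_G[of 1] m_pos d_first by simp
  then obtain q where "neighbours G 1 = {q}" by (rule card_1_singletonE)
  then show ?thesis unfolding root_def by (simp only: the_elem_eq)
qed

lemma root_in: "root \<in> verts"
proof -
  have "root \<in> neighbours G 1" using neighbours_1 by simp
  then have "root \<in> {1..m}" "root \<noteq> 1" using neighbours_G(1,3)[of 1] by auto
  then show ?thesis by simp
qed

lemma one_neighbour_iff: "1 \<in> neighbours G j \<longleftrightarrow> j = root"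
  using neighbours_G(2)[of 1 j] neighbours_1 by simp

text \<open>Any choice works, but it must depend on nothing except the graph, \<open>j\<close> and
  \<open>p\<close>, so that trees with the same glued graph are compared through the same
  enumeration.\<close>

definition enum :: "nat \<Rightarrow> nat \<Rightarrow> nat \<Rightarrow> nat" where
  "enum j p = (SOME h. bij_betw h {..<d j - 1} (neighbours G j - {p}))"

lemma enum: "j \<in> verts \<Longrightarrow> p \<in> neighbours G j \<Longrightarrow>
  bij_betw (enum j p) {..<d j - 1} (neighbours G j - {p})"
  unfolding enum_def using neighbours_G(4) card_neighbours_G
  by (intro someI_ex[of "\<lambda>h. bij_betw h {..<d j - 1} (neighbours G j - {p})"] finite_same_card_bij)
    (auto simp: card_Diff_singleton)

definition children :: "(nat \<Rightarrow> nat \<Rightarrow> nat) \<Rightarrow> nat \<Rightarrow> nat \<Rightarrow> nat \<Rightarrow> nat" where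
  "children c j p i = enum j p (c j i)"

definition slot :: "(nat \<Rightarrow> nat \<Rightarrow> nat) \<Rightarrow> nat \<Rightarrow> nat \<Rightarrow> nat \<Rightarrow> nat" where
  "slot c j p = inv_into {..<d j - 1} (children c j p)"

end

context degree_sequence
begin

text \<open>A code prescribes at every vertex of the graph an order of the neighbours other than the
  parent. As the parent depends on the exploration, this is a permutation relative to a fixed
  enumeration of these neighbours for each possible parent; the number of codes depends on the
  degrees only.\<close>

definition codes :: "(nat \<Rightarrow> nat \<Rightarrow> nat) set" where
  "codes = PiE {2..m} (\<lambda>j. {f \<in> extensional {..<d j - 1}. bij_betw f {..<d j - 1} {..<d j - 1}})"

end

context target_graph
begin

lemma children_bij:
  assumes "c \<in> codes" "j \<in> verts" "p \<in> neighbours G j"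
  shows "bij_betw (children c j p) {..<d j - 1} (neighbours G j - {p})"
proof -
  have "bij_betw (c j) {..<d j - 1} {..<d j - 1}" using assms(1,2) by (auto simp: codes_def)
  then show ?thesis
    using bij_betw_trans[OF _ enum[OF assms(2,3)], of "c j"] by (simp add: children_def[abs_def] comp_def)
qed

lemma slot:
  assumes "c \<in> codes" "j \<in> verts" "p \<in> neighbours G j"
  shows "i < d j - 1 \<Longrightarrow> slot c j p (children c j p i) = i"
    "q \<in> neighbours G j - {p} \<Longrightarrow> slot c j p q < d j - 1 \<and> children c j p (slot c j p q) = q"
proof -
  note b = children_bij[OF assms]
  show "i < d j - 1 \<Longrightarrow> slot c j p (children c j p i) = i"
    unfolding slot_def using bij_betw_inv_into_left[OF b, of i] by simp
  assume q: "q \<in> neighbours G j - {p}"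
  then have "slot c j p q \<in> {..<d j - 1}"
    unfolding slot_def by (rule bij_betw_apply[OF bij_betw_inv_into[OF b]])
  then show "slot c j p q < d j - 1 \<and> children c j p (slot c j p q) = q"
    unfolding slot_def using bij_betw_inv_into_right[OF b q] by simp
qed

text \<open>Vertex 1 is cut off and becomes \<open>outside\<close>. It remains a neighbour of the
  root in \<open>G\<close>, so in both cases of \<open>slot_inj\<close> the vertex \<open>p\<close>
  is a genuine neighbour of \<open>j\<close> and \<open>enum j p\<close> enumerates the
  others.\<close>

lemma explored_graph:
  assumes c: "c \<in> codes"
  shows "explored_graph verts (\<lambda>j. neighbours G j - {1}) root 1 (slot c)"
proof
  fix j assume j: "j \<in> verts"
  show "neighbours G j - {1} \<subseteq> verts"
  proof
    fix q assume "q \<in> neighbours G j - {1}"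
    then have "q \<in> {1..m}" "q \<noteq> 1" using neighbours_G(1)[of j] by blast+
    then show "q \<in> verts" by simp
  qed
  show "j \<in> neighbours G q - {1}" if "q \<in> neighbours G j - {1}" for q
    using that j neighbours_G(2)[of j q] by simp
  show "q = q'" if "p \<in> neighbours G j - {1} \<or> j = root \<and> p = 1" "q \<in> neighbours G j - {1} - {p}"
    "q' \<in> neighbours G j - {1} - {p}" "slot c j p q = slot c j p q'" for p q q'
  proof -
    have p: "p \<in> neighbours G j" using that(1) one_neighbour_iff[of j] by blast
    have "q \<in> neighbours G j - {p}" "q' \<in> neighbours G j - {p}" using that(2,3) by blast+
    from slot(2)[OF c j p this(1)] slot(2)[OF c j p this(2)] that(4) show ?thesis by metis
  qed
next
  fix S assume S: "S \<subseteq> verts" "root \<in> S" "\<And>j. j \<in> S \<Longrightarrow> neighbours G j - {1} \<subseteq> S"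
  have "connected_graph G" using G by (simp add: connected_graphs_with_degrees_def)
  have "b \<in> insert 1 S" if "(1, b) \<in> {(a, b). {a, b} \<in> snd G}\<^sup>*" for b
    using that
  proof (induction rule: rtrancl_induct)
    case (step a b)
    then have "b \<in> neighbours G a" by (simp add: neighbours_def)
    show ?case
    proof (cases "a = 1")
      case True
      then have "b = root" using \<open>b \<in> neighbours G a\<close> neighbours_1 by simp
      then show ?thesis using S(2) by simp
    next
      case False
      then have "a \<in> S" using step(3) by blast
      then show ?thesis using S(3)[of a] \<open>b \<in> neighbours G a\<close> by blast
    qed
  qed blast
  moreover have "(1, b) \<in> {(a, b). {a, b} \<in> snd G}\<^sup>*" if "b \<in> verts" for b
    using \<open>connected_graph G\<close> fst_G m_pos that by (auto simp: connected_graph_def split_beta)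
  ultimately have "verts \<subseteq> insert 1 S" by blast
  then show "S = verts" using S(1) by force
qed (use root_in neighbours_G(3) in simp_all)

end

section \<open>Recovering the tree from the graph\<close>

context degree_sequence
begin

text \<open>Every child position becomes a vertex; for an exploration \<open>pos\<close> these are
  the words of graph vertices together with the leaves that mark edges outside the tree.\<close>

definition tree_of :: "(nat \<Rightarrow> vertex) \<Rightarrow> tree" where
  "tree_of pos = insert [] {pos j @ [i] | j i. j \<in> {2..m} \<and> i < d j - 1}"

text \<open>Two child positions that point at each other's vertices are the two halves of one edge
  outside the tree; the half at the vertex explored first plays the part of
  \<open>u\<close>.\<close>

definition pairs_of :: "(nat \<Rightarrow> vertex) \<Rightarrow> (nat \<Rightarrow> nat \<Rightarrow> nat) \<Rightarrow> (vertex \<times> vertex) set" where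
  "pairs_of pos b = {(pos j @ [i], pos q @ [i']) | j i q i'. j \<in> {2..m} \<and> q \<in> {2..m} \<and>
     i < d j - 1 \<and> i' < d q - 1 \<and> b j i = q \<and> b q i' = j \<and> pos j \<prec>\<^sub>D\<^sub>F pos q}"

lemma tree_of_cong: "(\<And>j. j \<in> {2..m} \<Longrightarrow> pos j = pos' j) \<Longrightarrow> tree_of pos = tree_of pos'"
  unfolding tree_of_def by (intro arg_cong[of _ _ "insert []"] Collect_cong) metis

lemma pairs_of_cong:
  "(\<And>j. j \<in> {2..m} \<Longrightarrow> pos j = pos' j) \<Longrightarrow>
    (\<And>j i. j \<in> {2..m} \<Longrightarrow> i < d j - 1 \<Longrightarrow> b j i = b' j i) \<Longrightarrow> pairs_of pos b = pairs_of pos' b'"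
  unfolding pairs_of_def by (intro Collect_cong ex_cong1) (auto)

end

section \<open>A marked tree is an exploration of its own graph\<close>

sublocale glued_tree \<subseteq> tgt: target_graph k m d "glued t x lab"
  by unfold_locales (rule glued_in_graphs, rule m_ge_2)

context glued_tree
begin

definition pos :: "nat \<Rightarrow> vertex" where
  "pos = inv_into kept lab"

lemma pos: "j \<in> {2..m} \<Longrightarrow> pos j \<in> kept" "j \<in> {2..m} \<Longrightarrow> lab (pos j) = j"
  using lab_surj[of j] inv_into_into[of j lab kept] f_inv_into_f[of j lab kept] unfolding pos_def by blast+

lemma pos_lab: "w \<in> kept \<Longrightarrow> pos (lab w) = w"
  unfolding pos_def using bij_lab_kept by (meson bij_betw_inv_into_left)

lemma root_eq: "tgt.root = lab []"
  using neighbours_first tgt.neighbours_1 by simp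

text \<open>The permutation that turns the fixed enumeration of the neighbours into the
  left-to-right order of the child positions at \<open>j\<close>.\<close>

definition code :: "nat \<Rightarrow> nat \<Rightarrow> nat" where
  "code = (\<lambda>j\<in>{2..m}. \<lambda>i\<in>{..<d j - 1}.
     inv_into {..<d j - 1} (tgt.enum j (up (pos j))) (down (pos j) i))"

lemma up_neighbour: "j \<in> {2..m} \<Longrightarrow> up (pos j) \<in> neighbours (glued t x lab) j"
  using neighbours_lab[OF pos(1)[of j]] pos(2)[of j] by simp

lemma down_pos_bij:
  "j \<in> {2..m} \<Longrightarrow> bij_betw (down (pos j)) {..<d j - 1} (neighbours (glued t x lab) j - {up (pos j)})"
  using down_bij[OF pos(1)[of j]] pos(2)[of j] by simp

lemma code_in_codes: "code \<in> codes"
  unfolding codes_def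
proof (rule PiE_I)
  fix j assume j: "j \<in> {2..m}"
  have "bij_betw (inv_into {..<d j - 1} (tgt.enum j (up (pos j))) \<circ> down (pos j)) {..<d j - 1} {..<d j - 1}"
    using down_pos_bij[OF j] bij_betw_inv_into[OF tgt.enum[OF j up_neighbour[OF j]]]
    by (rule bij_betw_trans)
  moreover have "code j i = (inv_into {..<d j - 1} (tgt.enum j (up (pos j))) \<circ> down (pos j)) i"
    if "i \<in> {..<d j - 1}" for i
    using j that by (simp add: code_def)
  ultimately have "bij_betw (code j) {..<d j - 1} {..<d j - 1}"
    using bij_betw_cong[of "{..<d j - 1}" "code j"] by blast
  then show "code j \<in> {f \<in> extensional {..<d j - 1}. bij_betw f {..<d j - 1} {..<d j - 1}}"
    using j by (simp add: code_def)
qed (auto simp: code_def)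

lemma children_code:
  assumes j: "j \<in> {2..m}" "i < d j - 1"
  shows "tgt.children code j (up (pos j)) i = down (pos j) i"
proof -
  have "down (pos j) i \<in> neighbours (glued t x lab) j - {up (pos j)}"
    using bij_betw_apply[OF down_pos_bij[OF j(1)], of i] j(2) by blast
  then show ?thesis
    using bij_betw_inv_into_right[OF tgt.enum[OF j(1) up_neighbour[OF j(1)]]] j
    unfolding tgt.children_def code_def by simp
qed

text \<open>Admissibility enters here: every edge down from \<open>w\<close> ends after
  \<open>parent w\<close>, whether it goes to a child, to the later end of a glued edge, or to its
  earlier end \<open>parent u\<close>, where \<open>w = parent v\<close>. Hence the parent is the
  first neighbour.\<close>

lemma dfs_pos:
  "explored_graph.dfs_labelling {2..m} (\<lambda>j. neighbours (glued t x lab) j - {1}) tgt.root 1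
     (tgt.slot code) pos (\<lambda>j. up (pos j))"
proof -
  interpret eg: explored_graph "{2..m}" "\<lambda>j. neighbours (glued t x lab) j - {1}" tgt.root 1 "tgt.slot code"
    by (rule tgt.explored_graph[OF code_in_codes])
  have "inj_on pos {2..m}" by (metis inj_onI pos(2))
  moreover have "pos tgt.root = []" "up (pos tgt.root) = 1"
    using pos_lab[OF root_kept] root_eq by (simp_all add: up_def)
  moreover have "up (pos q) \<in> neighbours (glued t x lab) q - {1} \<and>
      pos q = pos (up (pos q)) @ [tgt.slot code (up (pos q)) (up (pos (up (pos q)))) q] \<and>
       (\<forall>a\<in>neighbours (glued t x lab) q - {1}. \<not> pos a \<prec>\<^sub>D\<^sub>F pos (up (pos q)))"
    if q: "q \<in> {2..m} - {tgt.root}" for q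
  proof -
    define w where "w = pos q"
    have w: "w \<in> kept" "lab w = q" using pos q by (auto simp: w_def)
    then have ne: "w \<noteq> []" using q root_eq by auto
    define p where "p = lab (parent w)"
    have pk: "parent w \<in> kept" using parent_kept ne w by blast
    have p: "up w = p" "p \<in> {2..m}" "pos p = parent w"
      using ne pk pos_lab lab_kept by (auto simp: up_def p_def)
    have "parent w @ [last w] \<in> t" using w ne by simp
    then have lst: "last w < d p - 1" using child_iff[OF pk] by (simp add: p_def)
    have "down (pos p) (last w) = q"
      using p(3) ne far_end(3)[OF gluing, of w] w by (simp add: down_def)
    then have "tgt.slot code p (up (pos p)) q = last w"
      using tgt.slot(1)[OF code_in_codes p(2) up_neighbour[OF p(2)] lst] children_code[OF p(2) lst] by simp
    then have "pos q = pos p @ [tgt.slot code p (up (pos p)) q]"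
      using p(3) ne by (simp add: w_def[symmetric])
    moreover have "\<not> pos a \<prec>\<^sub>D\<^sub>F parent w" if a: "a \<in> neighbours (glued t x lab) q" "a \<noteq> 1" for a
    proof -
      from a w have "a = up w \<or> (\<exists>i<d (lab w) - 1. a = down w i)"
        using neighbours_lab[OF w(1)] by auto
      then show ?thesis
      proof (elim disjE exE conjE)
        assume "a = up w"
        then show ?thesis using p by simp
      next
        fix i assume i: "i < d (lab w) - 1" "a = down w i"
        let ?y = "w @ [i]"
        have y: "?y \<in> t" using i child_iff[OF w(1)] by simp
        then have "far_end x ?y \<in> kept" by (intro far_end_kept) auto
        then have pa: "pos a = far_end x ?y" using i(2) pos_lab by (simp add: down_def)
        have up: "parent w \<prec>\<^sub>D\<^sub>F w" using ne by (rule df_less_parent)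
        have "parent w \<prec>\<^sub>D\<^sub>F pos a"
        proof (cases "?y \<in> removed x")
          case True
          then show ?thesis
          proof (cases rule: removed_cases)
            case (1 v)
            then show ?thesis
              using df_less_trans[OF up] gluingD(5)[OF gluing 1] far_end(1)[OF gluing 1] pa by simp
          next
            case (2 u)
            then show ?thesis
              using gluingD(4)[OF gluing 2] far_end(2)[OF gluing 2] pa by simp
          qed
        next
          case False
          then show ?thesis
            using df_less_trans[OF up df_less_snoc] far_end(3)[OF gluing False] pa by simp
        qed
        then show ?thesis by (rule df_less_asym)
      qed
    qed
    moreover have "p \<in> neighbours (glued t x lab) q - {1}"
      using up_neighbour[of q] q p by (simp add: w_def)
    ultimately show ?thesis using p by (simp add: w_def[symmetric])
  qed
  ultimately show ?thesis unfolding eg.dfs_labelling_def by blast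
qed

text \<open>Together with \<open>pairs_of_pos\<close> this computes the marked tree from graph, code
  and exploration; as the exploration is unique, graph and code determine the marked tree.\<close>

lemma tree_of_pos: "tree_of pos = t"
proof (intro equalityI subsetI)
  fix y assume "y \<in> tree_of pos"
  then show "y \<in> t" using plane_treeD(2)[OF plane] child_iff[OF pos(1)] pos(2) unfolding tree_of_def by auto
next
  fix y assume y: "y \<in> t"
  show "y \<in> tree_of pos"
  proof (cases "y = []")
    case False
    define w where "w = parent y"
    have w: "w \<in> kept" "y = w @ [last y]" using parent_kept[OF y False] False by (auto simp: w_def)
    then have "pos (lab w) = w" "lab w \<in> {2..m}" "last y < d (lab w) - 1"
      using pos_lab lab_kept child_iff[OF w(1), of "last y"] y by auto
    then show ?thesis unfolding tree_of_def using w(2) by (metis (mono_tags, lifting) insertCI mem_Collect_eq)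
  qed (simp add: tree_of_def)
qed

lemma pairs_of_pos: "pairs_of pos (\<lambda>j. tgt.children code j (up (pos j))) = x"
proof -
  have "pairs_of pos (\<lambda>j. tgt.children code j (up (pos j))) = pairs_of pos (\<lambda>j. down (pos j))"
    using children_code by (intro pairs_of_cong) auto
  also have "\<dots> = x"
  proof (intro equalityI subrelI)
    fix y z assume "(y, z) \<in> pairs_of pos (\<lambda>j. down (pos j))"
    then obtain j i q i' where jq: "y = pos j @ [i]" "z = pos q @ [i']" "j \<in> {2..m}" "q \<in> {2..m}"
      "i < d j - 1" "i' < d q - 1" "down (pos j) i = q" "down (pos q) i' = j" "pos j \<prec>\<^sub>D\<^sub>F pos q"
      unfolding pairs_of_def by blast
    note k = pos(1)[OF jq(3)] pos(1)[OF jq(4)] and l = pos(2)[OF jq(3)] pos(2)[OF jq(4)]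
    have yz: "y \<in> t" "z \<in> t" using jq child_iff[OF k(1)] child_iff[OF k(2)] l by auto
    then have "far_end x y \<in> kept" using far_end_kept jq(1) by blast
    then have fy: "far_end x y = pos q" using jq(1,7) pos_lab unfolding down_def by metis
    show "(y, z) \<in> x"
    \<comment> \<open>\<open>y\<close> cannot be a second component, which would put
      \<open>pos q\<close> before \<open>pos j\<close>, nor a kept vertex, which would make position
      \<open>i'\<close> at \<open>q\<close> lead to the parent of \<open>q\<close>. So
      \<open>y\<close> is a first component, and injectivity of \<open>down\<close> identifies its
      partner.\<close>
    proof (cases "y \<in> removed x")
      case True
      then show ?thesis
      proof (cases rule: removed_cases)
        case (1 v)
        then have v: "parent v = pos q" "v = pos q @ [last v]" "v \<in> t"
          using fy far_end(1)[OF gluing 1] removed_parent[OF 1] by auto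
        then have "last v < d q - 1" using child_iff[OF k(2), of "last v"] l by simp
        moreover have "far_end x v = pos j" using far_end(2)[OF gluing 1] jq(1) by simp
        then have "down (pos q) (last v) = j" unfolding down_def v(2)[symmetric] using l by simp
        ultimately have "last v = i'"
          using inj_onD[OF inj_down[OF k(2)], of "last v" i'] jq l by simp
        then show ?thesis using 1 v(2) jq(2) by simp
      next
        case (2 u)
        then have "parent u = pos q" using fy far_end(2)[OF gluing 2] by simp
        then show ?thesis using gluingD(5)[OF gluing 2] jq(1,9) df_less_asym[of "pos j"] by simp
      qed
    next
      case False
      then have "pos q = pos j @ [i]" using far_end(3)[OF gluing False] fy jq(1) by simp
      then have "up (pos q) = j" using l by (simp add: up_def)
      then show ?thesis using down_neq_up[OF k(2), of i'] jq l by simp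
    qed
  next
    fix u v assume uv: "(u, v) \<in> x"
    note r = removed_parent[OF uv]
    define j q where "j = lab (parent u)" and "q = lab (parent v)"
    have "j \<in> {2..m}" "q \<in> {2..m}" "pos j = parent u" "pos q = parent v"
      using r lab_kept pos_lab by (auto simp: j_def q_def)
    moreover have "last u < d j - 1" "last v < d q - 1"
      using r child_iff[of "parent u" "last u"] child_iff[of "parent v" "last v"] by (auto simp: j_def q_def)
    moreover have "down (parent u) (last u) = q" "down (parent v) (last v) = j"
      unfolding down_def r(7,8)[symmetric] using far_end(1,2)[OF gluing uv] by (auto simp: j_def q_def)
    moreover have "parent u \<prec>\<^sub>D\<^sub>F parent v" by (rule gluingD(5)[OF gluing uv])
    moreover have "(u, v) = (parent u @ [last u], parent v @ [last v])" using r(7,8) by simp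
    ultimately show "(u, v) \<in> pairs_of pos (\<lambda>j. down (pos j))"
      unfolding pairs_of_def by (intro CollectI exI[of _ j] exI[of _ "last u"] exI[of _ q] exI[of _ "last v"]) simp
  qed
  finally show ?thesis .
qed

end

section \<open>Realising every code\<close>

lemma simple_graph_eqI:
  assumes "simple_graph G" "simple_graph H" "fst G = fst H"
    and "\<And>j. j \<in> fst G \<Longrightarrow> neighbours G j = neighbours H j"
  shows "G = H"
proof -
  have "e \<in> snd H" if "simple_graph G" "e \<in> snd G" "\<And>j. j \<in> fst G \<Longrightarrow> neighbours G j = neighbours H j"
    for e G H
  proof -
    have "e \<subseteq> fst G" "card e = 2" using that(1,2) by (auto simp: simple_graph_def split_beta)
    then obtain j q where e: "e = {j, q}" "j \<in> fst G" by (auto simp: card_2_iff)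
    then have "q \<in> neighbours G j" using that(2) by (simp add: neighbours_def)
    then have "q \<in> neighbours H j" using that(3)[OF e(2)] by simp
    then show ?thesis using e(1) by (simp add: neighbours_def)
  qed
  from this[OF assms(1)] this[OF assms(2)] have "snd G = snd H" using assms(3,4) by (metis subsetI subset_antisym)
  then show ?thesis using assms(3) by (simp add: prod_eq_iff)
qed

context degree_sequence
begin

lemma child_counts_eq_card:
  assumes "bij_betw lab t {2..m + 2 * k}" "\<And>w. w \<in> t \<Longrightarrow> num_children t w = child_seq m d (lab w)"
  shows "card {u \<in> t. num_children t u = i} = child_counts k m d i"
proof -
  have "bij_betw lab {u \<in> t. num_children t u = i} {j \<in> {2..m + 2 * k}. child_seq m d j = i}"
    unfolding bij_betw_def
  proof
    show "inj_on lab {u \<in> t. num_children t u = i}"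
      using assms(1) by (auto simp: bij_betw_def intro: inj_on_subset)
    show "lab ` {u \<in> t. num_children t u = i} = {j \<in> {2..m + 2 * k}. child_seq m d j = i}"
      using assms(2) unfolding bij_betw_imp_surj_on[OF assms(1), symmetric] by auto
  qed
  then show ?thesis unfolding child_counts_def by (rule bij_betw_same_card)
qed

end

section \<open>The marked tree built from an exploration\<close>

locale dfs_tree = target_graph +
  fixes c :: "nat \<Rightarrow> nat \<Rightarrow> nat" and pos :: "nat \<Rightarrow> vertex" and par :: "nat \<Rightarrow> nat"
  assumes c: "c \<in> codes"
    and dfs: "explored_graph.dfs_labelling verts (\<lambda>j. neighbours G j - {1}) root 1 (slot c) pos par"
begin

interpretation eg: explored_graph verts "\<lambda>j. neighbours G j - {1}" root 1 "slot c"
  by (rule explored_graph[OF c])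

lemma inj_pos: "i \<in> verts \<Longrightarrow> j \<in> verts \<Longrightarrow> pos i = pos j \<longleftrightarrow> i = j"
  and pos_root: "pos root = []" and par_root: "par root = 1"
  and par: "q \<in> verts \<Longrightarrow> q \<noteq> root \<Longrightarrow> par q \<in> neighbours G q - {1}"
    "q \<in> verts \<Longrightarrow> q \<noteq> root \<Longrightarrow> pos q = pos (par q) @ [slot c (par q) (par (par q)) q]"
    "q \<in> verts \<Longrightarrow> q \<noteq> root \<Longrightarrow> a \<in> neighbours G q - {1} \<Longrightarrow> \<not> pos a \<prec>\<^sub>D\<^sub>F pos (par q)"
  using dfs unfolding eg.dfs_labelling_def inj_on_def by blast+

lemma par_verts: "q \<in> verts \<Longrightarrow> q \<noteq> root \<Longrightarrow> par q \<in> verts"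
  using par(1) eg.N_subset by blast

lemma par_neighbour: "j \<in> verts \<Longrightarrow> par j \<in> neighbours G j"
  using par(1) par_root one_neighbour_iff by (cases "j = root") auto

definition child :: "nat \<Rightarrow> nat \<Rightarrow> nat" where
  "child j = children c j (par j)"

lemma child_bij: "j \<in> verts \<Longrightarrow> bij_betw (child j) {..<d j - 1} (neighbours G j - {par j})"
  unfolding child_def using children_bij[OF c _ par_neighbour] by blast

lemma child_neighbour: "j \<in> verts \<Longrightarrow> i < d j - 1 \<Longrightarrow> child j i \<in> neighbours G j \<and> child j i \<noteq> par j"
  using bij_betw_apply[OF child_bij, of j i] by auto

lemma child_verts: "j \<in> verts \<Longrightarrow> i < d j - 1 \<Longrightarrow> child j i \<in> verts"
  using child_neighbour[of j i] eg.N_subset[of j] one_neighbour_iff[of j] par_root by auto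

lemma child_inj: "j \<in> verts \<Longrightarrow> i < d j - 1 \<Longrightarrow> i' < d j - 1 \<Longrightarrow> child j i = child j i' \<longleftrightarrow> i = i'"
  using child_bij[of j] by (auto simp: bij_betw_def inj_on_def)

lemma child_surj: "j \<in> verts \<Longrightarrow> q \<in> neighbours G j \<Longrightarrow> q \<noteq> par j \<Longrightarrow> \<exists>i<d j - 1. child j i = q"
proof -
  assume j: "j \<in> verts" and "q \<in> neighbours G j" "q \<noteq> par j"
  then have "q \<in> child j ` {..<d j - 1}" unfolding bij_betw_imp_surj_on[OF child_bij[OF j]] by blast
  then show ?thesis by auto
qed

lemma par_child:
  assumes q: "q \<in> verts" "q \<noteq> root"
  obtains i where "i < d (par q) - 1" "child (par q) i = q" "pos q = pos (par q) @ [i]"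
proof
  let ?p = "par q"
  have p: "?p \<in> verts" by (rule par_verts[OF q])
  \<comment> \<open>\<open>slot\<close> is meaningful only off the parent of \<open>?p\<close>. Two
    parent steps shorten the word by two, so they do not return to \<open>q\<close>.\<close>
  have "par ?p \<noteq> q"
  proof (cases "?p = root")
    case True
    then show ?thesis using par_root q by auto
  next
    case False
    from par(2)[OF p False] par(2)[OF q] have "length (pos q) = length (pos (par ?p)) + 2"
      by (metis (no_types) add_Suc_right length_append_singleton one_add_one plus_1_eq_Suc add.commute)
    then show ?thesis by auto
  qed
  moreover have "q \<in> neighbours G ?p" using par(1)[OF q] neighbours_G(2) by blast
  ultimately have "q \<in> neighbours G ?p - {par ?p}" by simp
  from slot(2)[OF c p par_neighbour[OF p] this] show "slot c ?p (par ?p) q < d ?p - 1"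
    "child ?p (slot c ?p (par ?p) q) = q" by (simp_all add: child_def)
  show "pos q = pos ?p @ [slot c ?p (par ?p) q]" by (rule par(2)[OF q])
qed

lemma pos_snoc:
  assumes j: "j \<in> verts" and q: "q \<in> verts" "pos q = pos j @ [i]"
  shows "par q = j" "i < d j - 1" "child j i = q"
proof -
  have "q \<noteq> root" using pos_root q by auto
  then obtain i' where i': "i' < d (par q) - 1" "child (par q) i' = q" "pos q = pos (par q) @ [i']"
    using par_child q by blast
  then show *: "par q = j" using q(2) inj_pos[OF _ j] par_verts q(1) \<open>q \<noteq> root\<close> by auto
  show "i < d j - 1" "child j i = q" using i' q(2) unfolding * by auto
qed

text \<open>If position \<open>i\<close> at \<open>j\<close> is not taken by a tree child, the edge
  is not the parent edge of \<open>child j i\<close> and must reappear among the positions there: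
  these are the two halves of an edge outside the tree.\<close>

lemma child_back:
  assumes j: "j \<in> verts" "i < d j - 1" and ne: "pos j @ [i] \<noteq> pos (child j i)"
  obtains i' where "i' < d (child j i) - 1" "child (child j i) i' = j"
proof -
  let ?q = "child j i"
  have q: "?q \<in> verts" "j \<in> neighbours G ?q" using child_verts child_neighbour j neighbours_G(2) by blast+
  have "par ?q \<noteq> j"
  proof
    assume p: "par ?q = j"
    then have "?q \<noteq> root" using par_root j by auto
    with q(1) obtain i' where i': "i' < d j - 1" "child j i' = ?q" "pos ?q = pos j @ [i']"
      using par_child[of ?q] p by metis
    then show False using ne child_inj[OF j i'(1)] by metis
  qed
  then show ?thesis using child_surj[OF q] that by metis
qed

definition T :: tree where
  "T = tree_of pos"

definition X :: "(vertex \<times> vertex) set" where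
  "X = pairs_of pos child"

lemma pos_in_T: "j \<in> verts \<Longrightarrow> pos j \<in> T"
proof (cases "j = root")
  case False
  assume j: "j \<in> verts"
  from par_child[OF j False] obtain i where "i < d (par j) - 1" "pos j = pos (par j) @ [i]" .
  then show ?thesis unfolding T_def tree_of_def using par_verts[OF j False] by blast
qed (simp add: T_def tree_of_def pos_root)

lemma snoc_in_T_iff: "w @ [i] \<in> T \<longleftrightarrow> (\<exists>j\<in>verts. w = pos j \<and> i < d j - 1)"
  unfolding T_def tree_of_def by auto

lemma pos_snoc_in_T_iff: "j \<in> verts \<Longrightarrow> pos j @ [i] \<in> T \<longleftrightarrow> i < d j - 1"
  using inj_pos unfolding snoc_in_T_iff by auto

lemma num_children_T: "j \<in> verts \<Longrightarrow> num_children T (pos j) = d j - 1"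
  unfolding num_children_def pos_snoc_in_T_iff by simp

lemma num_children_T_0: "w \<notin> pos ` verts \<Longrightarrow> num_children T w = 0"
  unfolding num_children_def snoc_in_T_iff by auto

lemma card_T: "finite T" "card T = m - 1 + 2 * k"
proof -
  let ?f = "\<lambda>(j, i). pos j @ [i]"
  let ?S = "SIGMA j:verts. {..<d j - 1}"
  have T: "T = insert [] (?f ` ?S)" unfolding T_def tree_of_def by auto
  have "inj_on ?f ?S" using inj_pos by (auto simp: inj_on_def)
  then have "card (?f ` ?S) = (\<Sum>j\<in>verts. d j - 1)" by (simp add: card_image)
  moreover show "finite T" unfolding T by simp
  moreover have "[] \<notin> ?f ` ?S" by auto
  ultimately have "card T = Suc (\<Sum>j\<in>verts. d j - 1)" unfolding T by simp
  then show "card T = m - 1 + 2 * k" using sum_child_seq[OF m_ge] by simp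
qed

lemma plane_T: "plane_tree T"
proof -
  have "u \<in> T \<and> (\<forall>j<i. u @ [j] \<in> T)" if "u @ [i] \<in> T" for u i
    using that pos_in_T unfolding snoc_in_T_iff by force
  moreover have "[] \<in> T" by (simp add: T_def tree_of_def)
  ultimately show ?thesis using card_T(1) unfolding plane_tree_def by blast
qed

lemma XD:
  assumes "(u, v) \<in> X"
  obtains j i q i' where "u = pos j @ [i]" "v = pos q @ [i']" "j \<in> verts" "q \<in> verts"
    "i < d j - 1" "i' < d q - 1" "child j i = q" "child q i' = j" "pos j \<prec>\<^sub>D\<^sub>F pos q"
  using assms unfolding X_def pairs_of_def by blast

lemma XI:
  assumes "j \<in> verts" "q \<in> verts" "i < d j - 1" "i' < d q - 1" "child j i = q" "child q i' = j"
    "pos j \<prec>\<^sub>D\<^sub>F pos q"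
  shows "(pos j @ [i], pos q @ [i']) \<in> X"
  using assms unfolding X_def pairs_of_def by blast

text \<open>By \<open>child_back\<close> a position without a graph vertex has a partner position,
  and the depth-first order decides which of the two comes first in the pair. Conversely, a paired
  position cannot hold a graph vertex: it would hold \<open>q\<close> with parent \<open>j\<close>,
  but \<open>child q i'\<close> is never the parent of \<open>q\<close>.\<close>

lemma removed_X: "removed X = T - pos ` verts"
proof (intro equalityI subsetI)
  fix y assume y: "y \<in> removed X"
  have "pos j @ [i] \<in> T - pos ` verts"
    if "j \<in> verts" "i < d j - 1" "child j i = q" "child q i' = j" "i' < d q - 1" "q \<in> verts" for j i q i'
  proof -
    have "pos j @ [i] \<noteq> pos q2" if "q2 \<in> verts" for q2
    proof
      assume *: "pos j @ [i] = pos q2"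
      have "par q = j" using pos_snoc[OF \<open>j \<in> verts\<close> \<open>q2 \<in> verts\<close> *[symmetric]] \<open>child j i = q\<close> by simp
      then show False using child_neighbour[OF \<open>q \<in> verts\<close> \<open>i' < d q - 1\<close>] \<open>child q i' = j\<close> by simp
    qed
    then have "pos j @ [i] \<notin> pos ` verts" by blast
    then show ?thesis using that(1,2) pos_snoc_in_T_iff by blast
  qed
  note end_in = this
  from y show "y \<in> T - pos ` verts"
  proof (cases rule: removed_cases)
    case (1 v)
    from XD[OF 1] show ?thesis using end_in by metis
  next
    case (2 u)
    from XD[OF 2] show ?thesis using end_in by metis
  qed
next
  fix y assume y: "y \<in> T - pos ` verts"
  then have "y \<noteq> []" using root_in pos_root by force
  then have "parent y @ [last y] \<in> T" using y by simp
  then obtain j i where ji: "j \<in> verts" "y = pos j @ [i]" "i < d j - 1"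
    unfolding snoc_in_T_iff using \<open>y \<noteq> []\<close> by (metis append_butlast_last_id)
  define q where "q = child j i"
  have q: "q \<in> verts" using child_verts ji by (simp add: q_def)
  have "pos j @ [i] \<noteq> pos (child j i)" using y ji(2) q by (auto simp: q_def)
  from child_back[OF ji(1,3) this] obtain i' where i': "i' < d q - 1" "child q i' = j"
    by (auto simp: q_def)
  have "j \<noteq> q" using child_neighbour[OF ji(1,3)] neighbours_G(3)[of j] by (auto simp: q_def)
  then consider "pos j \<prec>\<^sub>D\<^sub>F pos q" | "pos q \<prec>\<^sub>D\<^sub>F pos j"
    using df_less_linear[of "pos j" "pos q"] inj_pos[OF ji(1) q] by blast
  then show "y \<in> removed X"
  proof cases
    case 1
    from XI[OF ji(1) q ji(3) i'(1) q_def[symmetric] i'(2) 1] show ?thesis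
      by (force simp: removed_def ji(2))
  next
    case 2
    from XI[OF q ji(1) i'(1) ji(3) i'(2) q_def[symmetric] 2] show ?thesis
      by (force simp: removed_def ji(2))
  qed
qed

lemma X_leaves: "(u, v) \<in> X \<Longrightarrow> u \<in> leaves T \<and> v \<in> leaves T"
proof -
  assume "(u, v) \<in> X"
  then have "u \<in> removed X" "v \<in> removed X" by (force simp: removed_def)+
  then show ?thesis using num_children_T_0 unfolding removed_X leaves_def by blast
qed

lemma gluing_X: "gluing T X"
proof -
  have det: "u = u' \<longleftrightarrow> v = v'" "u \<noteq> v'"
    "parent u = parent u' \<Longrightarrow> parent v = parent v' \<Longrightarrow> u = u' \<and> v = v'"
    if "(u, v) \<in> X" "(u', v') \<in> X" for u v u' v'
  proof -
    from XD[OF that(1)] obtain j i q i' where a: "u = pos j @ [i]" "v = pos q @ [i']" "j \<in> verts" "q \<in> verts"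
      "i < d j - 1" "i' < d q - 1" "child j i = q" "child q i' = j" "pos j \<prec>\<^sub>D\<^sub>F pos q" .
    from XD[OF that(2)] obtain j2 i2 q2 i2' where b: "u' = pos j2 @ [i2]" "v' = pos q2 @ [i2']" "j2 \<in> verts" "q2 \<in> verts"
      "i2 < d j2 - 1" "i2' < d q2 - 1" "child j2 i2 = q2" "child q2 i2' = j2" "pos j2 \<prec>\<^sub>D\<^sub>F pos q2" .
    show "u = u' \<longleftrightarrow> v = v'"
      using a b inj_pos child_inj by (metis append1_eq_conv)
    show "u \<noteq> v'"
      using a b inj_pos[OF a(3) b(4)] df_less_asym[OF a(9)] by auto
    show "parent u = parent u' \<Longrightarrow> parent v = parent v' \<Longrightarrow> u = u' \<and> v = v'"
      using a b inj_pos child_inj by (metis butlast_snoc)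
  qed
  have adm: "(u, v) \<in> admissible_pairs T" if uv: "(u, v) \<in> X" for u v
  proof -
    from XD[OF uv] obtain j i q i' where a: "u = pos j @ [i]" "v = pos q @ [i']" "j \<in> verts" "q \<in> verts"
      "i < d j - 1" "i' < d q - 1" "child j i = q" "child q i' = j" "pos j \<prec>\<^sub>D\<^sub>F pos q" .
    have q: "q \<noteq> root" using a(9) pos_root by auto
    have "parent (pos q) = pos (par q)" using arg_cong[OF par(2)[OF a(4) q], of butlast] by simp
    then have pp: "parent (parent v) = pos (par q)" using a(2) by simp
    have "j \<in> neighbours G q - {1}" "j \<noteq> par q" using child_neighbour[OF a(4,6)] a(3,8) by auto
    \<comment> \<open>\<open>j\<close> and \<open>par q\<close> are different neighbours of
      \<open>q\<close>, and the parent comes first; this is the lower bound in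
      admissibility.\<close>
    then have "pos (par q) \<prec>\<^sub>D\<^sub>F pos j"
      using par(3)[OF a(4) q, of j] df_less_linear[of "pos (par q)" "pos j"] inj_pos[OF par_verts[OF a(4) q] a(3)] by blast
    moreover have "pos q \<noteq> []" using a(9) by auto
    ultimately show ?thesis using X_leaves[OF uv] a(1,2,9) pp by (simp add: admissible_pairs_iff)
  qed
  have "X \<subseteq> T \<times> T" using X_leaves by (auto simp: leaves_def)
  then have "finite X" using card_T(1) finite_subset by blast
  then show ?thesis using adm det by (rule gluingI)
qed

lemma kept_eq: "T - removed X = pos ` verts"
  using removed_X pos_in_T by auto

text \<open>The degree sum decides the number of pairs: \<open>T\<close> has
  \<open>m - 1 + 2 * k\<close> vertices, of which \<open>m - 1\<close> carry graph vertices, and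
  each pair accounts for two of the others.\<close>

lemma card_X: "card X = k"
proof -
  have "inj_on pos verts" using inj_pos by (auto simp: inj_on_def)
  then have "card (pos ` verts) = m - 1" by (simp add: card_image)
  then have "card (removed X) = 2 * k"
    unfolding removed_X using card_T pos_in_T by (subst card_Diff_subset) auto
  then show ?thesis using card_removed(2)[OF gluing_X] by simp
qed

lemma labelled:
  obtains lab where "glued_tree k m d T X lab" "\<And>j. j \<in> verts \<Longrightarrow> lab (pos j) = j"
proof -
  have inj: "inj_on pos verts" using inj_pos by (auto simp: inj_on_def)
  have "bij_betw (inv_into verts pos) (T - removed X) verts"
    unfolding kept_eq using inj by (simp add: bij_betw_inv_into inj_on_imp_bij_betw)
  moreover have "num_children T w = d (inv_into verts pos w) - 1" if "w \<in> T - removed X" for w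
    using that num_children_T inj unfolding kept_eq by auto
  ultimately obtain lab where lab: "lab \<in> labelings m d T (ordered_list X)"
    "\<And>w. w \<in> T - removed X \<Longrightarrow> lab w = inv_into verts pos w"
    using labelings_extend[OF gluing_X, where f = "inv_into verts pos" and m = m and d = d] removed_X m_pos
    by blast
  have lab_pos: "lab (pos j) = j" if "j \<in> verts" for j
    using lab(2)[of "pos j"] inj that unfolding kept_eq by simp
  have ps: "length (ordered_list X) = k" using gluing_ordered_list(4)[OF gluing_X] card_X by simp
  have bij: "bij_betw lab T {2..m + 2 * k}" using lab(1) ps by (simp add: labelings_def)
  have img: "lab ` removed X = {m + 1..m + 2 * k}"
    using image_removed[OF gluing_X, of lab m] lab(1) ps card_X by (simp add: labelings_def)
  have "num_children T w = child_seq m d (lab w)" if w: "w \<in> T" for w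
  proof (cases "w \<in> removed X")
    case True
    then have "num_children T w = 0" unfolding removed_X using num_children_T_0 by blast
    moreover have "lab w > m" using imageI[OF True, of lab] unfolding img by simp
    ultimately show ?thesis by (simp add: child_seq_def)
  next
    case False
    then obtain j where "j \<in> verts" "w = pos j" using w kept_eq by blast
    then show ?thesis using num_children_T lab_pos by (simp add: child_seq_def)
  qed
  from child_counts_eq_card[OF bij this] have "T \<in> trees_with_counts (child_counts k m d)"
    using plane_T by (simp add: trees_with_counts_def)
  then have "(T, X) \<in> marked_trees"
    using gluing_X card_X by (simp add: ordered_trees_with_collections_iff)
  then have "glued_tree k m d T X lab" using lab(1) by unfold_locales
  then show ?thesis using lab_pos that by blast
qed

text \<open>In the tree built here, \<open>up\<close> and \<open>down\<close> turn out to be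
  \<open>par\<close> and \<open>child\<close>, from which both the neighbourhoods of
  \<open>G\<close> and the permutations of \<open>c\<close> can be read off.\<close>

lemma code_surj:
  assumes "glued_tree k m d T X lab" and lab: "\<And>j. j \<in> verts \<Longrightarrow> lab (pos j) = j"
  shows "glued T X lab = G" "glued_tree.code m d T X lab = c"
proof -
  interpret gt: glued_tree k m d T X lab by fact
  have pos_kept: "pos j \<in> T - removed X" if "j \<in> verts" for j using that kept_eq by blast
  have up: "gt.up (pos j) = par j" if j: "j \<in> verts" for j
  proof (cases "j = root")
    case False
    then have "pos j \<noteq> [] \<and> parent (pos j) = pos (par j)" using par(2)[OF j False] by simp
    then show ?thesis using lab[OF par_verts[OF j False]] by (simp add: gt.up_def)
  qed (simp add: gt.up_def pos_root par_root)
  have down: "gt.down (pos j) i = child j i" if j: "j \<in> verts" "i < d j - 1" for j i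
  proof (cases "pos j @ [i] \<in> removed X")
    case True
    then have "far_end X (pos j @ [i]) = pos (child j i)"
    proof (cases rule: removed_cases)
      case (1 v)
      then show ?thesis
      proof (cases rule: XD)
        case (1 j2 i2 q i')
        then have "j2 = j" "i2 = i" using inj_pos[OF j(1) 1(3)] by auto
        then show ?thesis using 1(2,7) far_end(1)[OF gluing_X \<open>(pos j @ [i], v) \<in> X\<close>] by simp
      qed
    next
      case (2 u)
      then show ?thesis
      proof (cases rule: XD)
        case (1 q i' j2 i2)
        then have "j2 = j" "i2 = i" using inj_pos[OF j(1) 1(4)] by auto
        then show ?thesis using 1(1,8) far_end(2)[OF gluing_X \<open>(u, pos j @ [i]) \<in> X\<close>] by simp
      qed
    qed
    then show ?thesis using lab[OF child_verts[OF j]] by (simp add: gt.down_def)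
  next
    case False
    then obtain q where q: "q \<in> verts" "pos q = pos j @ [i]"
      using pos_snoc_in_T_iff[OF j(1), of i] j(2) removed_X by auto
    then show ?thesis
      using pos_snoc(3)[OF j(1) q] far_end(3)[OF gluing_X False] lab[OF q(1)] by (simp add: gt.down_def)
  qed
  have nb: "neighbours (glued T X lab) j = neighbours G j" if "j \<in> {1..m}" for j
  proof (cases "j = 1")
    case True
    then show ?thesis using gt.neighbours_first neighbours_1 lab[OF root_in] pos_root by simp
  next
    case False
    then have j: "j \<in> verts" using that by auto
    have "neighbours (glued T X lab) j = insert (par j) (child j ` {..<d j - 1})"
      using gt.neighbours_lab[OF pos_kept[OF j]] lab[OF j] up[OF j] down[OF j] by simp
    also have "\<dots> = neighbours G j"
      using bij_betw_imp_surj_on[OF child_bij[OF j]] par_neighbour[OF j] by auto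
    finally show ?thesis .
  qed
  show eq: "glued T X lab = G"
    using nb fst_G gt.fst_glued by (intro simple_graph_eqI gt.simple_glued simple_G) auto
  have gpos: "gt.pos j = pos j" if "j \<in> verts" for j
    using gt.pos_lab[OF pos_kept[OF that]] lab[OF that] by simp
  show "gt.code = c"
  proof (rule PiE_ext[OF gt.code_in_codes[unfolded codes_def] c[unfolded codes_def]])
    fix j assume j: "j \<in> verts"
    have cj: "c j \<in> extensional {..<d j - 1}" "bij_betw (c j) {..<d j - 1} {..<d j - 1}"
      using c j by (auto simp: codes_def)
    have "gt.code j \<in> extensional {..<d j - 1}" using j by (simp add: gt.code_def)
    then show "gt.code j = c j"
    proof (rule extensionalityI[OF _ cj(1)])
      fix i assume i: "i \<in> {..<d j - 1}"
      then have "inv_into {..<d j - 1} (enum j (par j)) (child j i) = c j i"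
        using bij_betw_inv_into_left[OF enum[OF j par_neighbour[OF j]] bij_betw_apply[OF cj(2) i]]
        by (simp add: child_def children_def)
      moreover have "gt.code j i = inv_into {..<d j - 1} (enum j (gt.up (gt.pos j))) (gt.down (gt.pos j) i)"
        using j i unfolding gt.code_def eq by simp
      moreover have "gt.down (pos j) i = child j i" using down[OF j] i by simp
      ultimately show "gt.code j i = c j i" unfolding gpos[OF j] up[OF j] by simp
    qed
  qed
qed

end

section \<open>Uniformity\<close>

lemma labelings_agree_on_removed:
  assumes "gluing t x" "lab \<in> labelings m d t (ordered_list x)" "lab' \<in> labelings m d t (ordered_list x)"
    "y \<in> removed x"
  shows "lab y = lab' y"
proof -
  obtain a where a: "a \<in> x" "y = fst a \<or> y = snd a" using assms(4) by (auto simp: removed_def)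
  then obtain j where "j < length (ordered_list x)" "a = ordered_list x ! j"
    using gluing_ordered_list(1)[OF assms(1)] by (metis in_set_conv_nth)
  then show ?thesis using assms(2,3) a(2) by (auto simp: labelings_def)
qed

text \<open>Used to match the kept vertices, grouped by number of children, with the labels from 2
  to \<open>m\<close>, grouped by degree.\<close>

lemma bij_betw_fibrewise:
  assumes "finite A" "finite B" "\<And>i. card {a \<in> A. f a = i} = card {b \<in> B. g b = i}"
  shows "\<exists>h. bij_betw h A B \<and> (\<forall>a\<in>A. g (h a) = f a)"
proof -
  have "\<forall>i. \<exists>h. bij_betw h {a \<in> A. f a = i} {b \<in> B. g b = i}"
    using assms by (intro allI finite_same_card_bij) auto
  then obtain h where h: "\<And>i. bij_betw (h i) {a \<in> A. f a = i} {b \<in> B. g b = i}" by metis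
  have fib: "h (f a) a \<in> B" "g (h (f a) a) = f a" if "a \<in> A" for a
    using bij_betw_apply[OF h, of a "f a"] that by auto
  have "bij_betw (\<lambda>a. h (f a) a) A B"
  proof (rule bij_betw_imageI)
    show "inj_on (\<lambda>a. h (f a) a) A"
    proof (rule inj_onI)
      fix a a' assume a: "a \<in> A" "a' \<in> A" "h (f a) a = h (f a') a'"
      then have "f a = f a'" using fib(2) by metis
      then show "a = a'" using a inj_onD[OF bij_betw_imp_inj_on[OF h[of "f a"]], of a a'] by simp
    qed
    show "(\<lambda>a. h (f a) a) ` A = B"
    proof (intro equalityI subsetI)
      fix b assume "b \<in> B"
      then have "b \<in> h (g b) ` {a \<in> A. f a = g b}" using bij_betw_imp_surj_on[OF h[of "g b"]] by simp
      then show "b \<in> (\<lambda>a. h (f a) a) ` A" by force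
    qed (use fib in auto)
  qed
  then show ?thesis using fib(2) by blast
qed

text \<open>With second stages of equal size \<open>L\<close> the pair drawn is uniform on
  \<open>Sigma A B\<close>, and a map whose fibres all have size \<open>C\<close> carries this to
  the uniform law on \<open>S\<close>. The constants need no evaluation, since the probabilities add
  up to 1.\<close>

lemma bind_pmf_of_set_uniform:
  assumes A: "finite A" "A \<noteq> {}" and B: "\<And>a. a \<in> A \<Longrightarrow> finite (B a)" "\<And>a. a \<in> A \<Longrightarrow> B a \<noteq> {}"
      "\<And>a. a \<in> A \<Longrightarrow> card (B a) = L"
    and S: "\<And>a b. a \<in> A \<Longrightarrow> b \<in> B a \<Longrightarrow> f a b \<in> S" "finite S"
      "\<And>s. s \<in> S \<Longrightarrow> card {(a, b) \<in> Sigma A B. f a b = s} = C"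
  shows "bind_pmf (pmf_of_set A) (\<lambda>a. bind_pmf (pmf_of_set (B a)) (\<lambda>b. return_pmf (f a b))) = pmf_of_set S"
    (is "?p = _")
proof -
  have fin: "finite (Sigma A B)" using A B by auto
  have pmf: "pmf ?p s = card {(a, b) \<in> Sigma A B. f a b = s} / (L * card A)" for s
  proof -
    have inner: "pmf (bind_pmf (pmf_of_set (B a)) (\<lambda>b. return_pmf (f a b))) s = card {b \<in> B a. f a b = s} / L"
      if a: "a \<in> A" for a
    proof -
      have "pmf (bind_pmf (pmf_of_set (B a)) (\<lambda>b. return_pmf (f a b))) s
          = (\<Sum>b\<in>B a. indicator {b. f a b = s} b) / L"
        using B[OF a] by (simp add: pmf_bind_pmf_of_set pmf_return indicator_def)
      also have "(\<Sum>b\<in>B a. indicator {b. f a b = s} b :: real) = card {b \<in> B a. f a b = s}"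
        using B(1)[OF a] by (simp add: indicator_def sum.If_cases Int_def)
      finally show ?thesis by simp
    qed
    have "{(a, b) \<in> Sigma A B. f a b = s} = Sigma A (\<lambda>a. {b \<in> B a. f a b = s})" by auto
    then have "card {(a, b) \<in> Sigma A B. f a b = s} = (\<Sum>a\<in>A. card {b \<in> B a. f a b = s})"
      using A(1) B(1) by simp
    then show ?thesis
      using A by (simp add: pmf_bind_pmf_of_set inner sum_divide_distrib[symmetric])
  qed
  obtain a b where ab: "a \<in> A" "b \<in> B a" using A(2) B(2) by blast
  then have "S \<noteq> {}" using S(1) by blast
  have "set_pmf ?p \<subseteq> S" using A B S(1) by auto
  define w where "w = real C / (L * card A)"
  have on_S: "pmf ?p s = w" if "s \<in> S" for s using pmf S(3)[OF that] by (simp add: w_def)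
  have "1 = (\<Sum>s\<in>S. pmf ?p s)" using sum_pmf_eq_1[OF S(2) \<open>set_pmf ?p \<subseteq> S\<close>] by simp
  also have "\<dots> = card S * w" using on_S by simp
  finally have w: "w = 1 / card S" using \<open>S \<noteq> {}\<close> S(2) by (simp add: field_simps)
  show ?thesis
  proof (rule pmf_eqI)
    fix s
    show "pmf ?p s = pmf (pmf_of_set S) s"
    proof (cases "s \<in> S")
      case True
      then show ?thesis using on_S w \<open>S \<noteq> {}\<close> S(2) by simp
    next
      case False
      then have "pmf ?p s = 0" using \<open>set_pmf ?p \<subseteq> S\<close> by (meson pmf_eq_0_set_pmf subsetD)
      then show ?thesis using False \<open>S \<noteq> {}\<close> S(2) by simp
    qed
  qed
qed

section \<open>Fibres of the gluing map and the number of labelings\<close>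

context degree_sequence
begin

abbreviation labellings_of :: "tree \<times> (vertex \<times> vertex) set \<Rightarrow> (vertex \<Rightarrow> nat) set" where
  "labellings_of \<equiv> \<lambda>(t, x). labelings m d t (ordered_list x)"

definition fibre :: "graph \<Rightarrow> ((tree \<times> (vertex \<times> vertex) set) \<times> (vertex \<Rightarrow> nat)) set" where
  "fibre G = {(a, lab) \<in> Sigma marked_trees labellings_of. case_prod glued a lab = G}"

lemma fibre_iff: "((t, x), lab) \<in> fibre G \<longleftrightarrow> glued_tree k m d t x lab \<and> glued t x lab = G"
  unfolding fibre_def glued_tree_def glued_tree_axioms_def using degree_sequence_axioms by auto

text \<open>Equal graphs and codes give equal slot functions, so both trees explore the same
  \<open>explored_graph\<close> and \<open>dfs_labelling_unique\<close> identifies them. The labels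
  of kept vertices are inverse to \<open>pos\<close>; those of removed vertices are fixed by the
  sorted collection.\<close>

lemma code_inj:
  assumes "glued_tree k m d t x lab" "glued_tree k m d t' x' lab'" "glued t x lab = glued t' x' lab'"
    "glued_tree.code m d t x lab = glued_tree.code m d t' x' lab'"
  shows "t = t' \<and> x = x' \<and> lab = lab'"
proof -
  interpret g: glued_tree k m d t x lab by fact
  interpret g': glued_tree k m d t' x' lab' by fact
  interpret eg: explored_graph "{2..m}" "\<lambda>j. neighbours (glued t x lab) j - {1}" g.tgt.root 1 "g.tgt.slot g.code"
    by (rule g.tgt.explored_graph[OF g.code_in_codes])
  note dfs' = g'.dfs_pos[folded assms(3,4)]
  have agree: "g.pos j = g'.pos j" "g.up (g.pos j) = g'.up (g'.pos j)" if "j \<in> {2..m}" for j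
    using eg.dfs_labelling_unique[OF dfs' g.dfs_pos that] by auto
  have t: "t = t'"
    using tree_of_cong[of g.pos g'.pos] agree(1) g.tree_of_pos g'.tree_of_pos by simp
  have "pairs_of g.pos (\<lambda>j. g.tgt.children g.code j (g.up (g.pos j))) =
      pairs_of g'.pos (\<lambda>j. g.tgt.children g.code j (g'.up (g'.pos j)))"
    using agree by (intro pairs_of_cong) simp_all
  then have x: "x = x'"
    using g.pairs_of_pos g'.pairs_of_pos assms(3,4) by simp
  have "lab y = lab' y" for y
  proof (cases "y \<in> t")
    case True
    show ?thesis
    proof (cases "y \<in> removed x")
      case True
      then show ?thesis using labelings_agree_on_removed[OF g.gluing g.lab] g'.lab t x by simp
    next
      case False
      then have y: "y \<in> t - removed x" using True by simp
      then have "g'.pos (lab y) = y" using agree(1) g.lab_kept[OF y] g.pos_lab[OF y] by simp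
      then show ?thesis using g'.pos(2)[OF g.lab_kept[OF y]] by simp
    qed
  next
    case False
    then show ?thesis using g.lab g'.lab t by (auto simp: labelings_def extensional_def)
  qed
  then show ?thesis using t x by blast
qed

lemma fibre_bij:
  assumes G: "G \<in> graphs" "m \<ge> 2"
  shows "bij_betw (\<lambda>((t, x), lab). glued_tree.code m d t x lab) (fibre G) codes"
proof (rule bij_betw_imageI)
  show "inj_on (\<lambda>((t, x), lab). glued_tree.code m d t x lab) (fibre G)" (is "inj_on ?F _")
  proof (rule inj_onI)
    fix a b assume ab: "a \<in> fibre G" "b \<in> fibre G" "?F a = ?F b"
    obtain t x lab t' x' lab' where "a = ((t, x), lab)" "b = ((t', x'), lab')" by (metis surj_pair)
    with ab show "a = b" using code_inj[of t x lab t' x' lab'] by (simp add: fibre_iff)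
  qed
  show "(\<lambda>((t, x), lab). glued_tree.code m d t x lab) ` fibre G = codes"
  proof (intro equalityI subsetI)
    fix c assume "c \<in> (\<lambda>((t, x), lab). glued_tree.code m d t x lab) ` fibre G"
    then show "c \<in> codes" using glued_tree.code_in_codes by (auto simp: fibre_iff)
  next
    fix c assume c: "c \<in> codes"
    interpret tg: target_graph k m d G using G by unfold_locales
    interpret eg: explored_graph "{2..m}" "\<lambda>j. neighbours G j - {1}" tg.root 1 "tg.slot c"
      by (rule tg.explored_graph[OF c])
    obtain pos par where "eg.dfs_labelling pos par" using eg.dfs_labelling_exists by blast
    then interpret dt: dfs_tree k m d G c pos par using c by unfold_locales
    obtain lab where lab: "glued_tree k m d dt.T dt.X lab" "\<And>j. j \<in> {2..m} \<Longrightarrow> lab (pos j) = j"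
      using dt.labelled by blast
    from dt.code_surj[OF this] lab(1) have "((dt.T, dt.X), lab) \<in> fibre G"
      "glued_tree.code m d dt.T dt.X lab = c" by (simp_all add: fibre_iff)
    then show "c \<in> (\<lambda>((t, x), lab). glued_tree.code m d t x lab) ` fibre G" by force
  qed
qed

lemma finite_codes: "finite codes"
proof -
  have "finite {f \<in> extensional {..<n}. bij_betw f {..<n} {..<n}}" for n :: nat
  proof (rule finite_subset)
    show "{f \<in> extensional {..<n}. bij_betw f {..<n} {..<n}} \<subseteq> {..<n} \<rightarrow>\<^sub>E {..<n}"
      by (auto simp: PiE_def dest: bij_betw_imp_funcset)
    show "finite ({..<n} \<rightarrow>\<^sub>E {..<n})" by (intro finite_PiE) auto
  qed
  then show ?thesis unfolding codes_def by (intro finite_PiE) auto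
qed

lemma finite_graphs: "finite graphs"
proof (rule finite_subset)
  show "graphs \<subseteq> {{1..m}} \<times> Pow (Pow {1..m})"
    by (fastforce simp: connected_graphs_with_degrees_def simple_graph_def split_beta mem_Times_iff)
qed auto

text \<open>The \<open>2 * k\<close> removed leaves account exactly for the \<open>2 * k\<close>
  extra zeros of the child sequence, so kept vertices with \<open>i\<close> children and labels of
  degree \<open>i + 1\<close> are equally many.\<close>

lemma labellings_nonempty:
  assumes "(t, x) \<in> marked_trees"
  shows "labelings m d t (ordered_list x) \<noteq> {}"
proof -
  have x: "gluing t x" "card x = k" and t: "plane_tree t" "\<And>i. card {u \<in> t. num_children t u = i} = child_counts k m d i"
    using assms by (auto simp: ordered_trees_with_collections_iff trees_with_counts_def)
  have fin: "finite t" using plane_treeD(1)[OF t(1)] .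
  have leaves: "removed x \<subseteq> leaves t" by (rule removed_subset_leaves[OF x(1)])
  then have sub: "removed x \<subseteq> t" by (auto simp: leaves_def)
  have count: "card {w \<in> t - removed x. num_children t w = i} = card {n \<in> {2..m}. d n - 1 = i}" for i
  proof -
    have "{u \<in> t. num_children t u = i} =
        {w \<in> t - removed x. num_children t w = i} \<union> (if i = 0 then removed x else {})"
      using leaves by (auto simp: leaves_def)
    moreover have "card ({w \<in> t - removed x. num_children t w = i} \<union> removed x) =
        card {w \<in> t - removed x. num_children t w = i} + card (removed x)"
      using fin card_removed(1)[OF x(1)] by (intro card_Un_disjoint) auto
    ultimately have 1: "card {u \<in> t. num_children t u = i} =
        card {w \<in> t - removed x. num_children t w = i} + (if i = 0 then 2 * k else 0)"
      using card_removed(2)[OF x(1)] x(2) by (cases "i = 0") simp_all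
    have "{j \<in> {2..m + 2 * k}. child_seq m d j = i} =
        {n \<in> {2..m}. d n - 1 = i} \<union> (if i = 0 then {m + 1..m + 2 * k} else {})"
      using m_pos by (auto simp: child_seq_def)
    moreover have "card ({n \<in> {2..m}. d n - 1 = i} \<union> {m + 1..m + 2 * k}) =
        card {n \<in> {2..m}. d n - 1 = i} + card {m + 1..m + 2 * k}"
      by (intro card_Un_disjoint) auto
    ultimately have "child_counts k m d i = card {n \<in> {2..m}. d n - 1 = i} + (if i = 0 then 2 * k else 0)"
      unfolding child_counts_def by (cases "i = 0") simp_all
    then show ?thesis using 1 t(2)[of i] by simp
  qed
  obtain f where "bij_betw f (t - removed x) {2..m}" "\<And>w. w \<in> t - removed x \<Longrightarrow> num_children t w = d (f w) - 1"
    using bij_betw_fibrewise[of "t - removed x" "{2..m}" "num_children t" "\<lambda>n. d n - 1"] count fin by auto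
  then show ?thesis using labelings_extend[OF x(1) sub, of f m d] m_pos by blast
qed

text \<open>These permutations act simply transitively on the labelings of every marked tree, which
  replaces the product of factorials.\<close>

definition relabellings :: "(nat \<Rightarrow> nat) set" where
  "relabellings = {s \<in> extensional {2..m + 2 * k}. bij_betw s {2..m + 2 * k} {2..m + 2 * k} \<and>
     (\<forall>n\<in>{m + 1..m + 2 * k}. s n = n) \<and> (\<forall>n\<in>{2..m}. d (s n) - 1 = d n - 1)}"

lemma card_labellings:
  assumes tx: "(t, x) \<in> marked_trees"
  shows "card (labelings m d t (ordered_list x)) = card relabellings"
proof -
  obtain lab0 where lab0: "lab0 \<in> labelings m d t (ordered_list x)" using labellings_nonempty[OF tx] by blast
  then interpret g: glued_tree k m d t x lab0 using tx by unfold_locales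
  let ?I = "{2..m + 2 * k}"
  let ?ps = "ordered_list x"
  have ps: "length ?ps = k" "set ?ps = x"
    using gluing_ordered_list(1,4)[OF g.gluing] g.card_x by auto
  have ps_t: "fst (?ps ! j) \<in> t" "snd (?ps ! j) \<in> t" if "j < k" for j
  proof -
    have "?ps ! j \<in> x" using that ps nth_mem by metis
    then show "fst (?ps ! j) \<in> t" "snd (?ps ! j) \<in> t"
      using g.removed_t by (auto simp: removed_def)
  qed
  have inv: "inv_into t lab0 n \<in> t" "lab0 (inv_into t lab0 n) = n" if "n \<in> ?I" for n
    using that g.bij_lab bij_betw_inv_into_right[OF g.bij_lab that] bij_betw_apply[OF bij_betw_inv_into[OF g.bij_lab] that] by auto
  have "bij_betw (\<lambda>s. restrict (s \<circ> lab0) t) relabellings (labelings m d t ?ps)"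
  proof (rule bij_betw_byWitness[where f' = "\<lambda>lab. restrict (lab \<circ> inv_into t lab0) ?I"])
    show "\<forall>s\<in>relabellings. restrict (restrict (s \<circ> lab0) t \<circ> inv_into t lab0) ?I = s"
      using inv by (auto simp: relabellings_def fun_eq_iff restrict_def extensional_def)
    show "\<forall>lab\<in>labelings m d t ?ps. restrict (restrict (lab \<circ> inv_into t lab0) ?I \<circ> lab0) t = lab"
    proof
      fix lab assume "lab \<in> labelings m d t ?ps"
      then have "lab \<in> extensional t" by (simp add: labelings_def)
      then show "restrict (restrict (lab \<circ> inv_into t lab0) ?I \<circ> lab0) t = lab"
        using bij_betwE[OF g.bij_lab] bij_betw_inv_into_left[OF g.bij_lab]
        by (auto simp: fun_eq_iff restrict_def extensional_def)
    qed
    show "(\<lambda>s. restrict (s \<circ> lab0) t) ` relabellings \<subseteq> labelings m d t ?ps"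
    proof (intro image_subsetI)
      fix s assume "s \<in> relabellings"
      then have s: "bij_betw s ?I ?I" "\<And>n. n \<in> {m + 1..m + 2 * k} \<Longrightarrow> s n = n"
        "\<And>n. n \<in> {2..m} \<Longrightarrow> d (s n) - 1 = d n - 1" by (auto simp: relabellings_def)
      let ?lab = "restrict (s \<circ> lab0) t"
      have "bij_betw ?lab t ?I"
        using bij_betw_trans[OF g.bij_lab s(1)] bij_betw_cong[of t ?lab "s \<circ> lab0" ?I] by simp
      moreover have "?lab (fst (?ps ! j)) = m + 2 * j + 1" "?lab (snd (?ps ! j)) = m + 2 * j + 2" if "j < k" for j
        using lab0 ps ps_t[OF that] that s(2) by (simp_all add: labelings_def)
      moreover have "num_children t w = d (?lab w) - 1" if w: "w \<in> t" "?lab w \<le> m" for w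
      proof -
        have I: "lab0 w \<in> ?I" using w g.bij_lab bij_betwE by blast
        have "lab0 w \<le> m"
        proof (rule ccontr)
          assume "\<not> lab0 w \<le> m"
          then have "s (lab0 w) = lab0 w" using I s(2) by simp
          then show False using w \<open>\<not> lab0 w \<le> m\<close> by simp
        qed
        then have "num_children t w = d (lab0 w) - 1" using lab0 w(1) by (simp add: labelings_def)
        then show ?thesis using s(3)[of "lab0 w"] I \<open>lab0 w \<le> m\<close> w(1) by simp
      qed
      ultimately show "?lab \<in> labelings m d t ?ps"
        using ps by (simp add: labelings_def)
    qed
    show "(\<lambda>lab. restrict (lab \<circ> inv_into t lab0) ?I) ` labelings m d t ?ps \<subseteq> relabellings"
    proof (intro image_subsetI)
      fix lab assume lab: "lab \<in> labelings m d t ?ps"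
      then interpret h: glued_tree k m d t x lab using tx by unfold_locales
      let ?s = "restrict (lab \<circ> inv_into t lab0) ?I"
      have "bij_betw ?s ?I ?I"
        using bij_betw_trans[OF bij_betw_inv_into[OF g.bij_lab] h.bij_lab]
          bij_betw_cong[of ?I ?s "lab \<circ> inv_into t lab0" ?I] by simp
      moreover have "?s n = n" if n: "n \<in> {m + 1..m + 2 * k}" for n
      proof -
        obtain y where y: "y \<in> removed x" "lab0 y = n" using g.lab_removed n by (metis imageE)
        then have "inv_into t lab0 n = y"
          using bij_betw_inv_into_left[OF g.bij_lab, of y] g.removed_t by auto
        moreover have "n \<in> ?I" using n m_pos by auto
        ultimately show ?thesis using labelings_agree_on_removed[OF g.gluing lab lab0 y(1)] y(2) by simp
      qed
      moreover have "d (?s n) - 1 = d n - 1" if n: "n \<in> {2..m}" for n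
      proof -
        obtain w where w: "w \<in> t - removed x" "lab0 w = n" using g.lab_surj[OF n] by blast
        then have "inv_into t lab0 n = w"
          using bij_betw_inv_into_left[OF g.bij_lab, of w] by auto
        moreover have "n \<in> ?I" using n by auto
        ultimately have "?s n = lab w" by simp
        then show ?thesis using g.num_children_kept[OF w(1)] h.num_children_kept[OF w(1)] w(2) by simp
      qed
      ultimately show "?s \<in> relabellings" by (simp add: relabellings_def)
    qed
  qed
  then show ?thesis by (simp add: bij_betw_same_card)
qed

text \<open>Nonemptiness of \<open>graphs\<close> is part of the claim because
  \<open>pmf_of_set\<close> is meaningful only for nonempty sets.\<close>

lemma random_graph_uniform:
  assumes "marked_trees \<noteq> {}"
  shows "graphs \<noteq> {}" "random_graph k m d = pmf_of_set graphs"
proof -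
  have gt: "glued_tree k m d t x lab" if "(t, x) \<in> marked_trees" "lab \<in> labelings m d t (ordered_list x)" for t x lab
    using that by unfold_locales
  obtain t x where tx: "(t, x) \<in> marked_trees" using assms by auto
  then obtain lab where lab: "glued_tree k m d t x lab" using labellings_nonempty gt by blast
  then have m2: "m \<ge> 2" by (rule glued_tree.m_ge_2)
  show "graphs \<noteq> {}" using glued_tree.glued_in_graphs[OF lab] by blast
  let ?f = "\<lambda>(t, x) lab. glued t x lab"
  have in_graphs: "?f a lab \<in> graphs" if "a \<in> marked_trees" "lab \<in> labellings_of a" for a lab
  proof -
    obtain t x where "a = (t, x)" by (cases a)
    then show ?thesis using glued_tree.glued_in_graphs[OF gt[of t x lab]] that by simp
  qed
  \<comment> \<open>Finiteness of the sample space is a by-product: there are finitely many graphs,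
    each with a finite fibre.\<close>
  have "Sigma marked_trees labellings_of \<subseteq> (\<Union>G\<in>graphs. fibre G)"
    using in_graphs by (auto simp: fibre_def)
  moreover have "finite (fibre G)" if "G \<in> graphs" for G
    using bij_betw_finite[OF fibre_bij[OF that m2]] finite_codes by simp
  ultimately have fin: "finite (Sigma marked_trees labellings_of)"
    using finite_graphs finite_subset by (metis (no_types, lifting) finite_UN_I)
  have ne: "labellings_of a \<noteq> {}" if "a \<in> marked_trees" for a
    using labellings_nonempty that by (cases a) auto
  have "marked_trees \<subseteq> fst ` Sigma marked_trees labellings_of" using ne by force
  then have "finite marked_trees" using fin finite_surj by blast
  moreover have "finite (labellings_of a)" if "a \<in> marked_trees" for a
  proof (rule finite_surj[OF fin])
    show "labellings_of a \<subseteq> snd ` Sigma marked_trees labellings_of" using that by force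
  qed
  moreover have "card {(a, lab) \<in> Sigma marked_trees labellings_of. ?f a lab = G} = card codes" if "G \<in> graphs" for G
    using bij_betw_same_card[OF fibre_bij[OF that m2]] by (simp add: fibre_def)
  ultimately have "bind_pmf (pmf_of_set marked_trees) (\<lambda>a. bind_pmf (pmf_of_set (labellings_of a))
      (\<lambda>lab. return_pmf (?f a lab))) = pmf_of_set graphs"
    using assms ne in_graphs finite_graphs card_labellings
    by (intro bind_pmf_of_set_uniform[where L = "card relabellings" and C = "card codes"]) auto
  then show "random_graph k m d = pmf_of_set graphs"
    unfolding random_graph_def by (simp add: split_beta' glued_def)
qed

end

section \<open>Existence of admissible collections\<close>

definition node :: "tree list \<Rightarrow> tree" where
  "node ts = insert [] (\<Union>i<length ts. (#) i ` (ts ! i))"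

text \<open>A multiset instead of the counts for each \<open>i\<close>, so that composing trees
  becomes addition.\<close>

definition child_mset :: "tree \<Rightarrow> nat multiset" where
  "child_mset t = image_mset (num_children t) (mset_set t)"

lemma count_child_mset: "finite t \<Longrightarrow> count (child_mset t) i = card {u \<in> t. num_children t u = i}"
  unfolding child_mset_def by (simp add: count_image_mset' conj_commute eq_commute)

lemma Cons_in_node_iff [simp]: "i # w \<in> node ts \<longleftrightarrow> i < length ts \<and> w \<in> ts ! i"
  unfolding node_def by auto

lemma Nil_in_node [simp]: "[] \<in> node ts"
  unfolding node_def by simp

context
  fixes ts :: "tree list"
  assumes ts: "\<forall>t\<in>set ts. plane_tree t"
begin

lemma plane_tree_nth: "i < length ts \<Longrightarrow> plane_tree (ts ! i)"
  using ts by simp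

lemma plane_tree_node: "plane_tree (node ts)"
proof -
  have "u \<in> node ts \<and> (\<forall>j<i. u @ [j] \<in> node ts)" if "u @ [i] \<in> node ts" for u i
  proof (cases u)
    case Nil
    then show ?thesis using that plane_treeD(2)[OF plane_tree_nth] by auto
  next
    case (Cons a w)
    then have a: "a < length ts" "w @ [i] \<in> ts ! a" using that by auto
    note t = plane_treeD(3,4)[OF plane_tree_nth[OF a(1)] a(2)]
    show ?thesis using Cons a(1) t by simp
  qed
  moreover have "finite (node ts)"
    using plane_treeD(1)[OF plane_tree_nth] by (auto simp: node_def)
  ultimately show ?thesis unfolding plane_tree_def using Nil_in_node by blast
qed

lemma num_children_node:
  "num_children (node ts) [] = length ts"
  "i < length ts \<Longrightarrow> num_children (node ts) (i # w) = num_children (ts ! i) w"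
proof -
  have "{i. [i] \<in> node ts} = {..<length ts}" using plane_treeD(2)[OF plane_tree_nth] by auto
  then show "num_children (node ts) [] = length ts" by (simp add: num_children_def)
qed (simp add: num_children_def)

lemma child_mset_node: "child_mset (node ts) = add_mset (length ts) (sum_list (map child_mset ts))"
proof -
  have fin: "finite (ts ! i)" if "i < length ts" for i using plane_treeD(1)[OF plane_tree_nth[OF that]] .
  have "image_mset (num_children (node ts)) (mset_set (\<Union>i<n. (#) i ` (ts ! i))) = (\<Sum>i<n. child_mset (ts ! i))"
    if "n \<le> length ts" for n
    using that
  proof (induction n)
    case (Suc n)
    have "(\<Union>i<Suc n. (#) i ` (ts ! i)) = (\<Union>i<n. (#) i ` (ts ! i)) \<union> (#) n ` (ts ! n)"
      by (simp add: lessThan_Suc Un_commute)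
    moreover have "mset_set ((\<Union>i<n. (#) i ` (ts ! i)) \<union> (#) n ` (ts ! n)) =
        mset_set (\<Union>i<n. (#) i ` (ts ! i)) + mset_set ((#) n ` (ts ! n))"
      using fin Suc.prems by (intro mset_set_Union) auto
    moreover have "image_mset (num_children (node ts)) (mset_set ((#) n ` (ts ! n))) = child_mset (ts ! n)"
    proof -
      have "mset_set ((#) n ` (ts ! n)) = image_mset ((#) n) (mset_set (ts ! n))"
        by (simp add: image_mset_mset_set)
      then show ?thesis
        using num_children_node(2)[of n] Suc.prems by (simp add: child_mset_def image_mset.compositionality comp_def)
    qed
    ultimately show ?case using Suc by simp
  qed simp
  from this[of "length ts"] have "image_mset (num_children (node ts)) (mset_set (\<Union>i<length ts. (#) i ` (ts ! i))) =
      sum_list (map child_mset ts)"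
    by (simp add: sum_list_sum_nth atLeast0LessThan)
  moreover have "mset_set (node ts) = add_mset [] (mset_set (\<Union>i<length ts. (#) i ` (ts ! i)))"
    unfolding node_def using fin by (subst mset_set.insert) auto
  ultimately show ?thesis using num_children_node(1) by (simp add: child_mset_def)
qed

lemma Cons_leaf_node: "i < length ts \<Longrightarrow> i # u \<in> leaves (node ts) \<longleftrightarrow> u \<in> leaves (ts ! i)"
  by (simp add: leaves_def num_children_node)

text \<open>Prepending a letter respects leaves and the depth-first order, and it commutes with
  \<open>parent\<close> on nonempty words, to which all components of a gluing belong.\<close>

lemma gluing_node:
  assumes i: "i < length ts" and x: "gluing (ts ! i) x"
  shows "gluing (node ts) (map_prod ((#) i) ((#) i) ` x)"
proof (rule gluingI)
  show "finite (map_prod ((#) i) ((#) i) ` x)" using x by (simp add: gluing_def)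
  have *: "\<exists>a b. u = i # a \<and> v = i # b \<and> (a, b) \<in> x \<and> parent u = i # parent a \<and> parent v = i # parent b"
    if "(u, v) \<in> map_prod ((#) i) ((#) i) ` x" for u v
    using that gluingD(6,7)[OF x] by auto
  show "(u, v) \<in> admissible_pairs (node ts)" if uv: "(u, v) \<in> map_prod ((#) i) ((#) i) ` x" for u v
  proof -
    from *[OF uv] obtain a b where ab: "u = i # a" "v = i # b" "(a, b) \<in> x"
      "parent u = i # parent a" "parent v = i # parent b" by blast
    note g = gluingD[OF x ab(3)]
    show ?thesis
      using Cons_leaf_node[OF i] g ab by (simp add: admissible_pairs_iff)
  qed
  fix u v u' v'
  assume uv: "(u, v) \<in> map_prod ((#) i) ((#) i) ` x" "(u', v') \<in> map_prod ((#) i) ((#) i) ` x"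
  from *[OF uv(1)] obtain a b where ab: "u = i # a" "v = i # b" "(a, b) \<in> x"
    "parent u = i # parent a" "parent v = i # parent b" by blast
  from *[OF uv(2)] obtain a' b' where ab': "u' = i # a'" "v' = i # b'" "(a', b') \<in> x"
    "parent u' = i # parent a'" "parent v' = i # parent b'" by blast
  note g = gluing_inj[OF x ab(3) ab'(3)]
  show "u = u' \<longleftrightarrow> v = v'" "u \<noteq> v'" using ab ab' g by simp_all
  show "parent u = parent u' \<Longrightarrow> parent v = parent v' \<Longrightarrow> u = u' \<and> v = v'" using ab ab' g(3) by simp
qed

end

abbreviation leaf :: tree where
  "leaf \<equiv> node []"

lemma leaf: "plane_tree leaf" "child_mset leaf = {#0#}" "[] \<in> leaves leaf"
  using plane_tree_node[of "[]"] child_mset_node[of "[]"] num_children_node(1)[of "[]"]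
  by (simp_all add: leaves_def)

lemma sum_list_replicate_single: "sum_list (replicate n {#a#}) = replicate_mset n a"
  by (induction n) auto

text \<open>Unless the tree is a single leaf, some entry \<open>c\<close> is positive. Its vertex
  gets \<open>c - 1\<close> leaves and, as remaining child, a tree for the other entries; removing
  \<open>c\<close> and \<open>c - 1\<close> zeros lowers sum and size by \<open>c\<close>
  each.\<close>

lemma plane_tree_exists:
  "sum_mset M + 1 = size M \<Longrightarrow> \<exists>t. plane_tree t \<and> child_mset t = M"
proof (induction "size M" arbitrary: M rule: less_induct)
  case less
  show ?case
  proof (cases "\<exists>c\<in>#M. c \<noteq> 0")
    case False
    then have "{#a \<in># M. a = 0#} = M" by (auto simp: filter_mset_eq_conv)
    then have M: "M = replicate_mset (count M 0) 0" by (metis filter_eq_replicate_mset)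
    have "sum_mset M = 0" by (subst M) simp
    moreover have "size M = count M 0" by (subst M) simp
    ultimately have "count M 0 = 1" using less.prems by linarith
    then have "M = {#0#}" using M by simp
    then show ?thesis using leaf by blast
  next
    case True
    then obtain c M1 where c: "c > 0" "M = add_mset c M1" by (metis gr0I insert_DiffM)
    define P where "P = filter_mset (\<lambda>a. a \<noteq> 0) M1"
    have M1: "M1 = replicate_mset (count M1 0) 0 + P"
      unfolding P_def by (metis filter_eq_replicate_mset multiset_partition)
    \<comment> \<open>Every positive entry is at least 1, so the balance of sum and size leaves
      enough zeros to take away.\<close>
    have "size P \<le> sum_mset P"
    proof -
      have "size (filter_mset (\<lambda>a. a \<noteq> 0) N) \<le> sum_mset (filter_mset (\<lambda>a. a \<noteq> 0) N)" for N :: "nat multiset"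
        by (induction N) auto
      then show ?thesis by (simp add: P_def)
    qed
    moreover have "size M1 = count M1 0 + size P" "sum_mset M1 = sum_mset P"
      by (subst M1, simp)+
    ultimately have ge: "count M1 0 \<ge> c - 1" using less.prems c by simp
    define M' where "M' = replicate_mset (count M1 0 - (c - 1)) 0 + P"
    have M1': "M1 = replicate_mset (c - 1) 0 + M'"
      by (subst M1) (use ge in \<open>simp add: M'_def multiset_eq_iff\<close>)
    have M: "M = add_mset c (replicate_mset (c - 1) 0 + M')" using c M1' by simp
    then have "size M' < size M" "sum_mset M' + 1 = size M'" using less.prems c(1) by simp_all
    from less.hyps[OF this] obtain t where t: "plane_tree t" "child_mset t = M'" by blast
    let ?ts = "t # replicate (c - 1) leaf"
    have "\<forall>s\<in>set ?ts. plane_tree s" using t leaf(1) by auto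
    from plane_tree_node[OF this] child_mset_node[OF this]
    have "plane_tree (node ?ts)" "child_mset (node ?ts) = M"
      using t c(1) M by (simp_all add: map_replicate_const leaf(2) sum_list_replicate_single)
    then show ?thesis by blast
  qed
qed

text \<open>Three vertices with \<open>c \<ge> 2\<close> children, namely a root and its first two children, carry an
  admissible pair and leave room for a further tree.\<close>

lemma gluing_exists:
  assumes c: "c \<ge> 2"
  shows "sum_mset M + 1 = size M \<Longrightarrow> 3 * k \<le> count M c \<Longrightarrow> (3 * c - 3) * k \<le> count M 0 \<Longrightarrow>
    \<exists>t x. plane_tree t \<and> child_mset t = M \<and> gluing t x \<and> card x = k"
proof (induction k arbitrary: M)
  case 0
  then obtain t where "plane_tree t" "child_mset t = M" using plane_tree_exists by blast
  moreover have "gluing t {}" by (simp add: gluing_def)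
  ultimately show ?case by fastforce
next
  case (Suc k)
  \<comment> \<open>Leaves: \<open>c - 2\<close> at the root, \<open>c - 1\<close> at its first
    child, which also carries the further tree, and \<open>c\<close> at its second child.\<close>
  define R where "R = replicate_mset 3 c + replicate_mset (3 * c - 3) 0"
  define M' where "M' = M - R"
  have "R \<subseteq># M"
    unfolding R_def subseteq_mset_def using c Suc.prems(2,3) by auto
  then have M: "M = R + M'" by (simp add: M'_def)
  have "sum_mset M' + 1 = size M'" using Suc.prems(1) c unfolding M by (simp add: R_def)
  moreover have "3 * k \<le> count M' c" "(3 * c - 3) * k \<le> count M' 0"
    using Suc.prems(2,3) c unfolding M by (simp_all add: R_def)
  ultimately obtain t x where t: "plane_tree t" "child_mset t = M'" "gluing t x" "card x = k"
    using Suc.IH by blast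
  \<comment> \<open>The further tree goes to position 1 of the first child, leaving
    \<open>[0, 0]\<close> as a leaf for the new pair.\<close>
  let ?as = "leaf # t # replicate (c - 2) leaf" and ?bs = "replicate c leaf"
  let ?ts = "node ?as # node ?bs # replicate (c - 2) leaf"
  have as: "\<forall>s\<in>set ?as. plane_tree s" using t leaf(1) by auto
  have bs: "\<forall>s\<in>set ?bs. plane_tree s" using leaf(1) by auto
  have "plane_tree (node ?as)" "plane_tree (node ?bs)"
    using plane_tree_node[OF as] plane_tree_node[OF bs] by blast+
  then have ts: "\<forall>s\<in>set ?ts. plane_tree s" using leaf(1) by auto
  have "child_mset (node ?as) = add_mset c (add_mset 0 (M' + replicate_mset (c - 2) 0))"
    using c t(2) by (subst child_mset_node[OF as])
      (simp_all add: map_replicate_const leaf(2) sum_list_replicate_single)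
  moreover have "child_mset (node ?bs) = add_mset c (replicate_mset c 0)"
    by (subst child_mset_node[OF bs]) (simp_all add: map_replicate_const leaf(2) sum_list_replicate_single)
  moreover have "child_mset (node ?ts) = add_mset c (child_mset (node ?as) + child_mset (node ?bs) + replicate_mset (c - 2) 0)"
    using c by (subst child_mset_node[OF ts])
      (simp_all add: map_replicate_const leaf(2) sum_list_replicate_single)
  ultimately have "child_mset (node ?ts) = add_mset c (add_mset c (add_mset 0 (M' + replicate_mset (c - 2) 0)) +
      add_mset c (replicate_mset c 0) + replicate_mset (c - 2) 0)" by simp
  also have "\<dots> = M"
    unfolding M R_def using c by (auto simp: multiset_eq_iff)
  finally have mset: "child_mset (node ?ts) = M" .
  define y where "y = map_prod ((#) 0) ((#) 0) ` map_prod ((#) 1) ((#) 1) ` x"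
  have "gluing (node ?as) (map_prod ((#) 1) ((#) 1) ` x)"
    using gluing_node[OF as, of 1 x] t(3) by simp
  then have y: "gluing (node ?ts) y"
    using gluing_node[OF ts, of 0 "map_prod ((#) 1) ((#) 1) ` x"] by (simp add: y_def)
  \<comment> \<open>All words of the old pairs properly extend \<open>[0, 1]\<close>, so no word or
    parent clashes with the new pair.\<close>
  have y_form: "\<exists>a b. u = 0 # 1 # a \<and> v = 0 # 1 # b \<and> a \<noteq> [] \<and> b \<noteq> []" if "(u, v) \<in> y" for u v
    using that gluingD(6,7)[OF t(3)] by (auto simp: y_def)
  \<comment> \<open>Here \<open>parent (parent v) = []\<close>, \<open>parent u = [0]\<close> and
    \<open>parent v = [1]\<close>.\<close>
  have "([0, 0], [1, 0]) \<in> admissible_pairs (node ?ts)"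
    using c leaf(3) Cons_leaf_node[OF as, of 0 "[]"] Cons_leaf_node[OF bs, of 0 "[]"]
      Cons_leaf_node[OF ts, of 0 "[0]"] Cons_leaf_node[OF ts, of 1 "[0]"]
    by (simp add: admissible_pairs_iff)
  moreover have "y \<subseteq> admissible_pairs (node ?ts)" "finite y" using y by (simp_all add: gluing_def)
  moreover have "u = u' \<longleftrightarrow> v = v'" "u \<noteq> v'"
    "parent u = parent u' \<Longrightarrow> parent v = parent v' \<Longrightarrow> u = u' \<and> v = v'"
    if uv: "(u, v) \<in> insert ([0, 0], [1, 0]) y" "(u', v') \<in> insert ([0, 0], [1, 0]) y" for u v u' v'
  proof -
    have new: "u \<noteq> [0, 0] \<and> u \<noteq> [1, 0] \<and> v \<noteq> [0, 0] \<and> v \<noteq> [1, 0] \<and> parent u \<noteq> [0] \<and> parent v \<noteq> [1]"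
      if "(u, v) \<in> y" for u v using y_form[OF that] by auto
    consider "(u, v) = ([0, 0], [1, 0])" "(u', v') = ([0, 0], [1, 0])"
      | "(u, v) = ([0, 0], [1, 0])" "(u', v') \<in> y" | "(u', v') = ([0, 0], [1, 0])" "(u, v) \<in> y"
      | "(u, v) \<in> y" "(u', v') \<in> y" using uv by blast
    then have "(u = u' \<longleftrightarrow> v = v') \<and> u \<noteq> v' \<and>
      (parent u = parent u' \<longrightarrow> parent v = parent v' \<longrightarrow> u = u' \<and> v = v')"
    proof cases
      case 4
      then show ?thesis using gluing_inj[OF y 4] by blast
    qed (use new in force)+
    then show "u = u' \<longleftrightarrow> v = v'" "u \<noteq> v'"
      "parent u = parent u' \<Longrightarrow> parent v = parent v' \<Longrightarrow> u = u' \<and> v = v'" by blast+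
  qed
  ultimately have "gluing (node ?ts) (insert ([0, 0], [1, 0]) y)"
    by (intro gluingI) (blast, blast, metis, metis, metis)
  moreover have "card (insert ([0, 0], [1, 0]) y) = Suc k"
  proof -
    have "([0, 0], [1, 0]) \<notin> y" using y_form by force
    moreover have "inj_on (map_prod ((#) i) ((#) i)) A" for i :: nat and A by (auto simp: inj_on_def)
    then have "card y = k" unfolding y_def t(4)[symmetric] by (simp only: card_image)
    ultimately show ?thesis using y by (simp add: gluing_def)
  qed
  ultimately show ?case using plane_tree_node[OF ts] mset by blast
qed

context degree_sequence
begin

lemma marked_trees_nonempty:
  assumes m: "m \<ge> 2" and c: "c \<ge> 2" "3 * k \<le> child_counts k m d c" "(3 * c - 3) * k \<le> child_counts k m d 0"
  shows "marked_trees \<noteq> {}"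
proof -
  define M where "M = image_mset (child_seq m d) (mset_set {2..m + 2 * k})"
  have count: "count M i = child_counts k m d i" for i
    unfolding M_def child_counts_def by (simp add: count_image_mset' conj_commute eq_commute)
  have "sum_mset M = (\<Sum>j\<in>{2..m + 2 * k}. child_seq m d j)"
    unfolding M_def by (simp add: sum_unfold_sum_mset)
  also have "\<dots> = (\<Sum>j\<in>{2..m}. d j - 1)"
    by (rule sum.mono_neutral_cong_right) (auto simp: child_seq_def)
  finally have "sum_mset M = (\<Sum>j\<in>{2..m}. d j - 1)" .
  moreover have "(\<Sum>j\<in>{2..m}. d j - 1) + 1 = m - 1 + 2 * k"
    by (rule sum_child_seq[OF m])
  ultimately have "sum_mset M + 1 = size M" using m unfolding M_def by simp
  then obtain t x where "plane_tree t" "child_mset t = M" "gluing t x" "card x = k"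
    using gluing_exists[OF c(1), of M k] c(2,3) count by auto
  moreover from this have "card {u \<in> t. num_children t u = i} = child_counts k m d i" for i
    using count count_child_mset plane_treeD(1) by metis
  ultimately have "(t, x) \<in> marked_trees"
    by (simp add: ordered_trees_with_collections_iff trees_with_counts_def)
  then show ?thesis by blast
qed

end

text \<open>Degrees 1 and 2 alone give a mean of \<open>2 - pmf p 1\<close>, which is less than 2. A
  degree of at least 3 supplies the vertices with two or more children that
  \<open>gluing_exists\<close> asks for.\<close>

lemma exists_pmf_pos_ge_3:
  fixes p :: "nat pmf"
  assumes "pmf p 0 = 0" "pmf p 1 > 0" "(\<lambda>i. real i * pmf p i) sums 2"
  shows "\<exists>i\<ge>3. pmf p i > 0"
proof (rule ccontr)
  assume "\<not> (\<exists>i\<ge>3. pmf p i > 0)"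
  then have zero: "pmf p i = 0" if "i \<ge> 3" for i
    using that pmf_nonneg[of p i] by (force simp: not_less)
  have in12: "i \<in> {1, 2}" if "pmf p i \<noteq> 0" for i
  proof -
    have "i \<noteq> 0" "i < 3" using that assms(1) zero[of i] by (auto intro: ccontr)
    then show ?thesis by auto
  qed
  then have supp: "\<And>i. i \<notin> {1, 2} \<Longrightarrow> pmf p i = 0" by blast
  then have "(\<Sum>i\<in>{1, 2}. pmf p i) = 1"
    using in12 by (intro sum_pmf_eq_1 subsetI) (simp_all only: set_pmf_iff finite.intros)
  moreover have "(\<lambda>i. real i * pmf p i) sums (\<Sum>i\<in>{1, 2}. real i * pmf p i)"
    using supp by (intro sums_finite) auto
  then have "(\<Sum>i\<in>{1, 2}. real i * pmf p i) = 2" using assms(3) sums_unique2 by blast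
  ultimately show False using assms(2) by simp
qed

lemma eventually_ge_of_ratio:
  fixes f :: "nat \<Rightarrow> nat"
  assumes "(\<lambda>m. real (f m) / real m) \<longlonglongrightarrow> a" "a > 0"
  shows "\<forall>\<^sub>F m in sequentially. b \<le> f m"
proof -
  have "filterlim (\<lambda>m. real (f m) / real m * real m) at_top sequentially"
    by (rule filterlim_tendsto_pos_mult_at_top[OF assms filterlim_real_sequentially])
  then have "\<forall>\<^sub>F m in sequentially. real b \<le> real (f m) / real m * real m"
    by (simp add: filterlim_at_top)
  then show ?thesis using eventually_gt_at_top[of 0] by eventually_elim simp
qed

text \<open>One is lost because vertex 1, possibly of degree \<open>Suc i\<close>, is not in the
  tree.\<close>

lemma child_counts_ge: "card {j \<in> {1..m}. d j = Suc i} - 1 \<le> child_counts k m d i"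
proof -
  have "{j \<in> {1..m}. d j = Suc i} - {1} \<subseteq> {j \<in> {2..m + 2 * k}. child_seq m d j = i}"
    by (auto simp: child_seq_def)
  then have "card ({j \<in> {1..m}. d j = Suc i} - {1}) \<le> child_counts k m d i"
    unfolding child_counts_def by (intro card_mono) auto
  moreover have "card {j \<in> {1..m}. d j = Suc i} - card {1 :: nat} \<le> card ({j \<in> {1..m}. d j = Suc i} - {1})"
    by (rule diff_card_le_card_Diff) simp
  ultimately show ?thesis by simp
qed

theorem theorem3p2:
  fixes k m0 :: nat and d :: "nat \<Rightarrow> nat \<Rightarrow> nat" and p :: "nat pmf"
  assumes m0: "m0 \<ge> 1"
    and deg_pos: "\<And>m j. m \<ge> m0 \<Longrightarrow> j \<in> {1..m} \<Longrightarrow> d m j \<ge> 1"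
    and deg_first: "\<And>m. m \<ge> m0 \<Longrightarrow> d m 1 = 1"
    and p_zero: "pmf p 0 = 0"
    and p_one: "pmf p 1 > 0"
    and p_mean: "(\<lambda>i. real i * pmf p i) sums 2"
    and p_second: "summable (\<lambda>i. (real i)\<^sup>2 * pmf p i)"
    and conv: "\<And>i. i \<ge> 1 \<Longrightarrow>
      (\<lambda>m. real (card {j \<in> {1..m}. d m j = i}) / real m) \<longlonglongrightarrow> pmf p i"
    and conv_second: "(\<lambda>m. (\<Sum>j = 1..m. (real (d m j))\<^sup>2) / real m)
      \<longlonglongrightarrow> (\<Sum>i. (real i)\<^sup>2 * pmf p i)"
    and deg_sum: "\<And>m. m \<ge> m0 \<Longrightarrow> (\<Sum>j = 1..m. d m j) = 2 * (m - 1) + 2 * k"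
  shows "(\<forall>\<^sub>F m in sequentially. ordered_trees_with_collections (child_counts k m (d m)) k \<noteq> {}) \<and>
    (\<forall>m\<ge>m0. ordered_trees_with_collections (child_counts k m (d m)) k \<noteq> {} \<longrightarrow>
      connected_graphs_with_degrees m (d m) \<noteq> {} \<and>
      random_graph k m (d m) = pmf_of_set (connected_graphs_with_degrees m (d m)))"
proof
  have loc: "degree_sequence k m (d m)" if "m \<ge> m0" for m
    using that m0 deg_pos deg_first deg_sum by unfold_locales auto
  obtain i where i: "i \<ge> 3" "pmf p i > 0"
    using exists_pmf_pos_ge_3[OF p_zero p_one p_mean] by blast
  \<comment> \<open>A vertex of degree \<open>i\<close> has \<open>i - 1\<close> children in the
    tree.\<close>
  define c where "c = i - 1"
  have c: "c \<ge> 2" "Suc c = i" using i(1) by (auto simp: c_def)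
  \<comment> \<open>The added 1 makes up for the loss in \<open>child_counts_ge\<close>. Degree
    \<open>Suc 0\<close> in the second bound means a leaf.\<close>
  have "\<forall>\<^sub>F m in sequentially. 3 * k + 1 \<le> card {j \<in> {1..m}. d m j = Suc c}"
    using conv[of i] i c(2) by (intro eventually_ge_of_ratio[of _ "pmf p i"]) auto
  moreover have "\<forall>\<^sub>F m in sequentially. (3 * c - 3) * k + 1 \<le> card {j \<in> {1..m}. d m j = Suc 0}"
    using conv[of 1] p_one by (intro eventually_ge_of_ratio[of _ "pmf p 1"]) auto
  ultimately show "\<forall>\<^sub>F m in sequentially. ordered_trees_with_collections (child_counts k m (d m)) k \<noteq> {}"
    using eventually_ge_at_top[of "max 2 m0"]
  proof eventually_elim
    case (elim m)
    then show ?case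
      using degree_sequence.marked_trees_nonempty[OF loc[of m] _ c(1)]
        child_counts_ge[where m = m and d = "d m" and i = c and k = k]
        child_counts_ge[where m = m and d = "d m" and i = 0 and k = k] by auto
  qed
  show "\<forall>m\<ge>m0. ordered_trees_with_collections (child_counts k m (d m)) k \<noteq> {} \<longrightarrow>
      connected_graphs_with_degrees m (d m) \<noteq> {} \<and>
      random_graph k m (d m) = pmf_of_set (connected_graphs_with_degrees m (d m))"
    using degree_sequence.random_graph_uniform[OF loc] by blast
qed

end
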